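(* Let $n,m\ge 0$ be integers with $2n+m\ge 1$ and $(n,m)\neq(0,1)$. For an integer $g$, let $\mathcal{P}_g$ denote the family of planar (simple) graphs having girth at least $g$. Then for all $g\ge 8(2n+m)$ we have $\chi_{n,m}(\mathcal{P}_g)=2(2n+m)+1$.
   Context: All graphs are finite. An $(n,m)$-graph $G$ is a graph with $n$ types of arcs (labeled $2,4,\ldots,2n$) and $m$ types of edges (labeled $2n+1,\ldots,2n+m$), whose underlying undirected graph $\mathrm{und}(G)$ is simple (so each adjacent pair of distinct vertices is joined by exactly one arc or exactly one edge, with exactly one type, and there are no loops). A homomorphism of an $(n,m)$-graph $G$ to an $(n,m)$-graph $H$ is a map $f:V(G)\to V(H)$ such that whenever $uv$ is an arc from $u$ to $v$ (resp. an edge) of type $\alpha$ in $G$, $f(u)f(v)$ is an arc from $f(u)$ to $f(v)$ (resp. an edge) of type $\alpha$ in $H$; write $G\to H$ if one exists. For an $(n,m)$-graph $G$, $\chi_{n,m}(G)=\min\{|V(H)|: H \text{ an } (n,m)\text{-graph},\ G\to H\}$. For a simple graph $S$, $\chi_{n,m}(S)=\max\{\chi_{n,m}(G): \mathrm{und}(G)=S\}$. For a family $\mathcal{F}$ of graphs, $\chi_{n,m}(\mathcal{F})=\max\{\chi_{n,m}(G): G\in\mathcal{F}\}$. The girth of a graph is the length of a shortest cycle (infinite if there is none). *)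

theory Defs
  imports "HOL-Analysis.Analysis" "HOL-Library.Extended_Nat" "HOL-Library.Infinite_Typeclass"
begin

section \<open>Finite simple graphs\<close>

record 'v sgraph =
  sverts :: "'v set"
  sedges :: "'v set set"

definition simple_graph :: "'v sgraph \<Rightarrow> bool" where
  "simple_graph S \<longleftrightarrow> finite (sverts S) \<and> (\<forall>e\<in>sedges S. e \<subseteq> sverts S \<and> card e = 2)"

text \<open>A cycle is listed without repeating its first vertex, so its length is the length of the list.\<close>

definition is_cycle :: "'v sgraph \<Rightarrow> 'v list \<Rightarrow> bool" where
  "is_cycle S xs \<longleftrightarrow> length xs \<ge> 3 \<and> distinct xs \<and> set xs \<subseteq> sverts S \<and>
     (\<forall>i<length xs. {xs ! i, xs ! (Suc i mod length xs)} \<in> sedges S)"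

text \<open>The infimum of the empty set is \<open>\<infinity>\<close>, the girth of a forest.\<close>

definition girth :: "'v sgraph \<Rightarrow> enat" where
  "girth S = (INF xs\<in>{xs. is_cycle S xs}. enat (length xs))"

text \<open>
  Planarity is topological: vertices are drawn as distinct points \<open>p v\<close> of the plane
  (represented by the type of complex numbers), each edge \<open>e\<close> as a simple arc \<open>\<gamma> e\<close> joining its
  two end points and passing through no other vertex, and two edges meet only in common end points.
\<close>

definition plane_drawing :: "'v sgraph \<Rightarrow> ('v \<Rightarrow> complex) \<Rightarrow> ('v set \<Rightarrow> real \<Rightarrow> complex) \<Rightarrow> bool" where
  "plane_drawing S p \<gamma> \<longleftrightarrow>
     inj_on p (sverts S) \<and>
     (\<forall>e\<in>sedges S. arc (\<gamma> e) \<and> {pathstart (\<gamma> e), pathfinish (\<gamma> e)} = p ` e \<and>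
        path_image (\<gamma> e) \<inter> p ` sverts S = p ` e) \<and>
     (\<forall>e\<in>sedges S. \<forall>f\<in>sedges S. e \<noteq> f \<longrightarrow>
        path_image (\<gamma> e) \<inter> path_image (\<gamma> f) \<subseteq> p ` (e \<inter> f))"

definition planar :: "'v sgraph \<Rightarrow> bool" where
  "planar S \<longleftrightarrow> (\<exists>p \<gamma>. plane_drawing S p \<gamma>)"

definition planar_girth :: "nat \<Rightarrow> 'v sgraph set" where
  "planar_girth g = {S. simple_graph S \<and> planar S \<and> enat g \<le> girth S}"


section \<open>Graphs with several types of arcs and edges\<close>

text \<open>
  \<open>(u, v, \<alpha>) \<in> arcs G\<close> is an arc of type \<open>\<alpha>\<close> from \<open>u\<close> to \<open>v\<close>;
  \<open>(e, \<alpha>) \<in> edges G\<close> is an undirected edge of type \<open>\<alpha>\<close> with set of end points \<open>e\<close>.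
\<close>

record 'v mixed_graph =
  verts :: "'v set"
  arcs :: "('v \<times> 'v \<times> nat) set"
  edges :: "('v set \<times> nat) set"

text \<open>
  Arc types are \<open>2, 4, \<dots>, 2n\<close> and edge types are \<open>2n+1, \<dots>, 2n+m\<close>. The last three conjuncts say that
  each pair of vertices is joined by at most one arc or edge, with only one type.
\<close>

definition nm_graph :: "nat \<Rightarrow> nat \<Rightarrow> 'v mixed_graph \<Rightarrow> bool" where
  "nm_graph n m G \<longleftrightarrow>
     finite (verts G) \<and>
     (\<forall>(u, v, \<alpha>)\<in>arcs G. u \<in> verts G \<and> v \<in> verts G \<and> u \<noteq> v \<and> even \<alpha> \<and> 2 \<le> \<alpha> \<and> \<alpha> \<le> 2 * n) \<and>
     (\<forall>(e, \<alpha>)\<in>edges G. e \<subseteq> verts G \<and> card e = 2 \<and> 2 * n + 1 \<le> \<alpha> \<and> \<alpha> \<le> 2 * n + m) \<and>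
     (\<forall>(u, v, \<alpha>)\<in>arcs G. \<forall>(u', v', \<beta>)\<in>arcs G. {u, v} = {u', v'} \<longrightarrow> (u, v, \<alpha>) = (u', v', \<beta>)) \<and>
     (\<forall>(e, \<alpha>)\<in>edges G. \<forall>(e', \<beta>)\<in>edges G. e = e' \<longrightarrow> \<alpha> = \<beta>) \<and>
     (\<forall>(u, v, \<alpha>)\<in>arcs G. \<forall>(e, \<beta>)\<in>edges G. {u, v} \<noteq> e)"

definition und :: "'v mixed_graph \<Rightarrow> 'v sgraph" where
  "und G = \<lparr>sverts = verts G, sedges = {{u, v} |u v \<alpha>. (u, v, \<alpha>) \<in> arcs G} \<union> fst ` edges G\<rparr>"

definition is_hom :: "'v mixed_graph \<Rightarrow> 'w mixed_graph \<Rightarrow> ('v \<Rightarrow> 'w) \<Rightarrow> bool" where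
  "is_hom G H f \<longleftrightarrow>
     f ` verts G \<subseteq> verts H \<and>
     (\<forall>(u, v, \<alpha>)\<in>arcs G. (f u, f v, \<alpha>) \<in> arcs H) \<and>
     (\<forall>(e, \<alpha>)\<in>edges G. (f ` e, \<alpha>) \<in> edges H)"

text \<open>
  Targets may be taken on vertices of type \<^typ>\<open>nat\<close>, since every finite graph is isomorphic
  to one of these.
\<close>

definition chi :: "nat \<Rightarrow> nat \<Rightarrow> 'v mixed_graph \<Rightarrow> nat" where
  "chi n m G =
     (LEAST k. \<exists>H :: nat mixed_graph. nm_graph n m H \<and> card (verts H) = k \<and> (\<exists>f. is_hom G H f))"

text \<open>
  For a finite simple graph \<open>S\<close> and \<open>2n+m \<ge> 1\<close> this is the maximum of a finite nonempty set, as
  \<^term>\<open>chi n m G\<close> is at most the number of vertices of \<open>G\<close>.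
\<close>

definition chi_simple :: "nat \<Rightarrow> nat \<Rightarrow> 'v sgraph \<Rightarrow> nat" where
  "chi_simple n m S = Max {chi n m G |G. nm_graph n m G \<and> und G = S}"

text \<open>
  \<^const>\<open>Max\<close> is meaningful on finite nonempty sets only, so statements about \<open>chi_family\<close> of an
  infinite family have to include the finiteness of the set of values.
\<close>

definition chi_family :: "nat \<Rightarrow> nat \<Rightarrow> 'v sgraph set \<Rightarrow> nat" where
  "chi_family n m F = Max (chi_simple n m ` F)"

end

theory Submission
  imports Defs
begin

text \<open>
  Write \<open>p = 2n + m\<close>.

  Upper bound. Walecki's decomposition of \<open>K\<^bsub>2p+1\<^esub>\<close> into \<open>p\<close> Hamiltonian cycles gives a target:
  an edge type receives one cycle, and an arc type two consecutive ones, each directed along the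
  cycle. For every kind of adjacency, the neighbourhood of a proper nonempty set \<open>A\<close> of colours
  has more than \<open>|A|\<close> elements, so a path of length \<open>l\<close> ending in an uncoloured vertex forbids at
  most \<open>2p - l\<close> colours there. Euler's formula and the girth make the graph so sparse that
  counting finds a vertex at which the incident threads together leave a colour.
  The needed part of Euler's formula follows from the Jordan curve theorem (an edge closing a
  cycle creates a face) and Janiszewski's theorem (an edge lies on at most two faces).

  Lower bound. In a target with at most \<open>2p\<close> vertices every vertex has a kind of adjacency with at
  most one neighbour. Following such kinds from the image of a vertex \<open>r\<close> gives a walk
  \<open>w\<^sub>0, w\<^sub>1, \<dots>\<close> that any path from \<open>r\<close> with the same kinds must copy. Two such paths of lengths
  \<open>L\<close> and \<open>L + 1\<close> with a common last vertex would force \<open>w\<^sub>L = w\<^bsub>L+1\<^esub>\<close>. A bouquet of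
  \<open>(2L+1)\<close>-cycles, one for each sequence of kinds, therefore maps to no such target.
\<close>

section \<open>Colouring sparse graphs with expanding relations\<close>

text \<open>The bound \<open>8p\<close> comes from the degrees that a light vertex can have. Give an
  index of length \<open>l\<close> the weight \<open>4p - l\<close>; sparsity makes the average
  weight around a vertex less than \<open>8p\<close>. An index with \<open>l >= 2p\<close>
  constrains nothing, so all weights may be taken to be at least \<open>2p + 1\<close>, and a light
  vertex has degree at most three. Degree one always leaves a colour, degree two is suppressed, and
  at degree three fewer than \<open>8p - 6p = 2p\<close> of the \<open>2p + 1\<close> colours are
  forbidden.

  An arc type needs two cycles because a single directed cycle is a permutation, under which no set
  grows; an undirected cycle already offers a successor and a predecessor map. This uses up
  \<open>2n + m = p\<close> cycles, all that Walecki provides. In both cases strict growth amounts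
  to the quotient of two permutations being again a single cycle, which is checked by following its
  orbit.

  In the lower bound the walk depends on the unknown target, so it must be fixed before a cycle of
  the bouquet is chosen; this is why every sequence of kinds has to occur.\<close>

definition expands :: "'c set \<Rightarrow> nat \<Rightarrow> ('c \<times> 'c) set \<Rightarrow> bool" where
  "expands C l R \<longleftrightarrow> R \<subseteq> C \<times> C \<and>
     (\<forall>A. A \<subseteq> C \<and> A \<noteq> {} \<longrightarrow> min (card A + l) (card C) \<le> card (R `` A) \<and> min (card A + l) (card C) \<le> card (R\<inverse> `` A))"

lemma expands_subset: "expands C l R \<Longrightarrow> R \<subseteq> C \<times> C"
  by (simp add: expands_def)

lemma expands_converse: "expands C l R \<Longrightarrow> expands C l (R\<inverse>)"
  unfolding expands_def by auto

lemma expands_card_Image: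
  "expands C l R \<Longrightarrow> A \<subseteq> C \<Longrightarrow> A \<noteq> {} \<Longrightarrow> min (card A + l) (card C) \<le> card (R `` A)"
  by (simp add: expands_def)

text \<open>Growth by \<open>k\<close> and growth by \<open>l\<close> add up thanks to the cap at
  \<open>card C\<close>: once the first step saturates, the second keeps the whole set. Both
  directions are demanded in \<open>expands\<close> so that a relation may be read from either
  end.\<close>

lemma expands_relcomp:
  assumes "finite C" "expands C k Q" "expands C l R"
  shows "expands C (k + l) (Q O R)"
proof -
  have *: "min (card A + (k + l)) (card C) \<le> card ((Q O R) `` A)"
    if Q: "expands C k Q" and R: "expands C l R" and A: "A \<subseteq> C" "A \<noteq> {}" for Q R k l A
  proof -
    have 1: "min (card A + k) (card C) \<le> card (Q `` A)"
      using Q A by (rule expands_card_Image)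
    have sub: "Q `` A \<subseteq> C"
      using Q by (auto simp: expands_def)
    have "card A > 0" "card C > 0"
      using A assms(1) by (auto simp: card_gt_0_iff dest: finite_subset)
    with 1 have "Q `` A \<noteq> {}"
      by auto
    with R sub have "min (card (Q `` A) + l) (card C) \<le> card (R `` (Q `` A))"
      by (rule expands_card_Image)
    with 1 show ?thesis
      by (simp add: relcomp_Image)
  qed
  have "min (card A + (k + l)) (card C) \<le> card ((Q O R)\<inverse> `` A)" if "A \<subseteq> C" "A \<noteq> {}" for A
    using *[OF expands_converse[OF assms(3)] expands_converse[OF assms(2)] that]
    by (simp add: converse_relcomp add.commute add.left_commute)
  moreover have "Q O R \<subseteq> C \<times> C"
    using assms(2,3) unfolding expands_def by auto
  ultimately show ?thesis
    unfolding expands_def using *[OF assms(2,3)] by blast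
qed

text \<open>Averaging over the vertices: as no index is a loop, each weight is counted at exactly
  two of them, whence the factor \<open>2\<close>.\<close>

lemma ex_light_vertex:
  fixes s t :: "'i \<Rightarrow> 'v" and w :: "'i \<Rightarrow> nat"
  assumes "finite I" "\<forall>i\<in>I. s i \<noteq> t i" "(\<Sum>i\<in>I. w i) < k * card (s ` I \<union> t ` I)"
  obtains v where "v \<in> s ` I \<union> t ` I" "(\<Sum>i\<in>{i\<in>I. s i = v \<or> t i = v}. w i) < 2 * k"
proof -
  define V where "V = s ` I \<union> t ` I"
  have fin: "finite V"
    using assms(1) by (simp add: V_def)
  have "(\<Sum>v\<in>V. \<Sum>i\<in>{i\<in>I. s i = v \<or> t i = v}. w i) = (\<Sum>v\<in>V. \<Sum>i\<in>I. if s i = v \<or> t i = v then w i else 0)"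
    using assms(1) by (simp add: sum.inter_filter)
  also have "\<dots> = (\<Sum>i\<in>I. \<Sum>v\<in>V. if s i = v \<or> t i = v then w i else 0)"
    by (rule sum.swap)
  also have "\<dots> = (\<Sum>i\<in>I. 2 * w i)"
  proof (rule sum.cong)
    fix i assume i: "i \<in> I"
    have "(\<Sum>v\<in>V. if s i = v \<or> t i = v then w i else 0) = (\<Sum>v\<in>{v\<in>V. s i = v \<or> t i = v}. w i)"
      using fin by (subst sum.inter_filter) auto
    also have "{v\<in>V. s i = v \<or> t i = v} = {s i, t i}"
      using i by (auto simp: V_def)
    finally show "(\<Sum>v\<in>V. if s i = v \<or> t i = v then w i else 0) = 2 * w i"
      using assms(2) i by simp
  qed simp
  also have "\<dots> = 2 * (\<Sum>i\<in>I. w i)"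
    by (simp add: sum_distrib_left)
  also have "\<dots> < card V * (2 * k)"
    using assms(3) unfolding V_def by (simp add: mult.commute)
  finally have lt: "(\<Sum>v\<in>V. \<Sum>i\<in>{i\<in>I. s i = v \<or> t i = v}. w i) < card V * (2 * k)" .
  have "\<exists>v\<in>V. (\<Sum>i\<in>{i\<in>I. s i = v \<or> t i = v}. w i) < 2 * k"
  proof (rule ccontr)
    assume "\<not> ?thesis"
    then have "card V * (2 * k) \<le> (\<Sum>v\<in>V. \<Sum>i\<in>{i\<in>I. s i = v \<or> t i = v}. w i)"
      using sum_bounded_below[of V "2 * k" "\<lambda>v. \<Sum>i\<in>{i\<in>I. s i = v \<or> t i = v}. w i"]
      by (simp add: not_less)
    with lt show False
      by simp
  qed
  then show thesis
    using that V_def by blast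
qed

text \<open>
  Suppressing a vertex of degree two amounts to composing the two relations and adding the
  lengths, so threads of the original graph never have to be handled. The sparsity condition
  is the one that Euler's formula gives for girth at least \<open>8p\<close>; it is inherited by suppression.
\<close>
lemma sparse_relational_colouring:
  fixes s t :: "'i \<Rightarrow> 'v" and l :: "'i \<Rightarrow> nat" and R :: "'i \<Rightarrow> ('c \<times> 'c) set"
  assumes C: "finite C" "card C = 2 * p + 1"
    and "finite I"
    and "\<forall>i\<in>I. expands C (l i) (R i)"
    and "\<forall>J. J \<subseteq> I \<and> J \<noteq> {} \<longrightarrow> 4 * p * card J + 4 * p \<le> 4 * p * card (s ` J \<union> t ` J) + sum l J"
  shows "\<exists>c. (\<forall>v. c v \<in> C) \<and> (\<forall>i\<in>I. (c (s i), c (t i)) \<in> R i)"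
  using assms(3-)
proof (induction "card I" arbitrary: I s t l R rule: less_induct)
  case less
  note fin = \<open>finite I\<close>
  note ex = less.prems(2)
  note sparse = less.prems(3)
  obtain c0 where c0: "c0 \<in> C"
    using C by fastforce
  show ?case
  proof (cases "\<exists>i\<in>I. l i \<ge> 2 * p")
    case True
    then obtain i where i: "i \<in> I" "l i \<ge> 2 * p"
      by blast
    have "\<exists>c. (\<forall>v. c v \<in> C) \<and> (\<forall>i\<in>I - {i}. (c (s i), c (t i)) \<in> R i)"
    proof (rule less.hyps)
      show "card (I - {i}) < card I"
        using fin i by (metis card_Diff1_less)
    qed (use fin ex sparse in auto)
    then obtain c where c: "\<forall>v. c v \<in> C" "\<forall>i\<in>I - {i}. (c (s i), c (t i)) \<in> R i"
      by blast
    have exi: "expands C (l i) (R i)"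
      using ex i by blast
    have "min (card {c (s i)} + l i) (card C) \<le> card (R i `` {c (s i)})"
      by (rule expands_card_Image[OF exi]) (use c in auto)
    then have "card C \<le> card (R i `` {c (s i)})"
      using i C by simp
    moreover have "R i `` {c (s i)} \<subseteq> C"
      using expands_subset[OF exi] by auto
    ultimately have "R i `` {c (s i)} = C"
      using C by (metis card_seteq)
    then have "(c (s i), c (t i)) \<in> R i"
      using c by blast
    with c show ?thesis
      by blast
  next
    case False
    then have short: "l i < 2 * p" if "i \<in> I" for i
      using that by (meson not_le)
    \<comment> \<open>For a loop the sparsity of \<open>{i}\<close> would read
      \<open>8p <= 4p + l i\<close>, against \<open>l i < 2p\<close>.\<close>
    have noloop: "\<forall>i\<in>I. s i \<noteq> t i"
    proof
      fix i assume i: "i \<in> I"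
      then have "4 * p * card {i} + 4 * p \<le> 4 * p * card (s ` {i} \<union> t ` {i}) + sum l {i}"
        using sparse by blast
      then show "s i \<noteq> t i"
        using short[OF i] by (auto simp: card_insert_if split: if_splits)
    qed
    show ?thesis
    proof (cases "I = {}")
      case True
      then show ?thesis using c0 by auto
    next
      case False
      \<comment> \<open>The weights \<open>4p - l i\<close> turn the sparsity of \<open>I\<close>
        itself into the hypothesis of \<open>ex_light_vertex\<close> with
        \<open>k = 4p\<close>.\<close>
      have "(\<Sum>i\<in>I. 4 * p - l i) + sum l I = (\<Sum>i\<in>I. 4 * p)"
        unfolding sum.distrib[symmetric] by (rule sum.cong) (use short in force)+
      moreover have "4 * p * card I + 4 * p \<le> 4 * p * card (s ` I \<union> t ` I) + sum l I"
        using sparse False by blast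
      moreover have "p > 0"
        using False short by fastforce
      ultimately have "(\<Sum>i\<in>I. 4 * p - l i) < 4 * p * card (s ` I \<union> t ` I)"
        by (simp add: mult.commute[of "card I"])
      then obtain v where v: "v \<in> s ` I \<union> t ` I"
        and light: "(\<Sum>i\<in>{i\<in>I. s i = v \<or> t i = v}. 4 * p - l i) < 2 * (4 * p)"
        using ex_light_vertex[OF fin noloop] by blast
      define D where "D = {i\<in>I. s i = v \<or> t i = v}"
      have D: "D \<subseteq> I" "finite D" "D \<noteq> {}"
        using fin v by (auto simp: D_def)
      \<comment> \<open>Each weight at \<open>v\<close> is at least \<open>2p + 1\<close>, so four
        of them would exceed \<open>8p\<close>.\<close>
      have "card D * (2 * p + 1) \<le> (\<Sum>i\<in>D. 4 * p - l i)"
        by (rule sum_bounded_below[where 'a=nat, simplified]) (use short D in force)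
      with light have "card D * (2 * p + 1) < 8 * p"
        by (simp add: D_def)
      then have "card D * (2 * p + 1) < 4 * (2 * p + 1)"
        by (rule less_le_trans) simp
      then have "card D < 4"
        by (metis mult_less_cancel2)
      \<comment> \<open>\<open>o' i\<close> is the end other than \<open>v\<close>, and
        \<open>Q i\<close> is the relation read towards \<open>v\<close>.\<close>
      define o' where "o' i = (if t i = v then s i else t i)" for i
      define Q where "Q i = (if t i = v then R i else (R i)\<inverse>)" for i
      have o': "o' i \<noteq> v" if "i \<in> D" for i
        using that noloop by (auto simp: o'_def D_def)
      have ends: "{s i, t i} = {v, o' i}" if "i \<in> D" for i
        using that by (auto simp: o'_def D_def)
      have Qex: "expands C (l i) (Q i)" if "i \<in> D" for i
        using that ex D by (auto simp: Q_def expands_converse)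
      have extend: "\<exists>c. (\<forall>v. c v \<in> C) \<and> (\<forall>i\<in>I. (c (s i), c (t i)) \<in> R i)"
        if c: "\<forall>v. c v \<in> C" "\<forall>i\<in>I - D. (c (s i), c (t i)) \<in> R i"
          and a: "a \<in> C" "\<forall>i\<in>D. (c (o' i), a) \<in> Q i" for c a
      proof (intro exI conjI allI ballI)
        fix u show "(c(v := a)) u \<in> C"
          using a c by auto
      next
        fix i assume i: "i \<in> I"
        show "((c(v := a)) (s i), (c(v := a)) (t i)) \<in> R i"
        proof (cases "i \<in> D")
          case True
          then show ?thesis
            using a(2) o'[OF True] noloop i unfolding D_def o'_def Q_def by (auto split: if_splits)
        next
          case False
          with i c(2) show ?thesis
            by (auto simp: D_def)
        qed
      qed
      show ?thesis
      proof (cases "card D = 2")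
        case True
        then obtain i j where ij: "D = {i, j}" "i \<noteq> j"
          by (auto simp: card_2_iff)
        then have iI: "i \<in> I" "j \<in> I"
          using D by auto
        \<comment> \<open>Suppression of \<open>v\<close>: \<open>i\<close> takes over the composed
          relation between the two other ends, and \<open>j\<close> disappears.\<close>
        define s' t' l' R' where "s' = s(i := o' i)" and "t' = t(i := o' j)"
          and "l' = l(i := l i + l j)" and "R' = R(i := Q i O (Q j)\<inverse>)"
        have "\<exists>c. (\<forall>v. c v \<in> C) \<and> (\<forall>k\<in>I - {j}. (c (s' k), c (t' k)) \<in> R' k)"
        proof (rule less.hyps[of _ l'])
          show "card (I - {j}) < card I"
            using fin iI by (metis card_Diff1_less)
          show "\<forall>k\<in>I - {j}. expands C (l' k) (R' k)"
          proof
            fix k assume "k \<in> I - {j}"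
            then show "expands C (l' k) (R' k)"
              using ex Qex[of i] Qex[of j] ij C(1)
              by (auto simp: l'_def R'_def intro!: expands_relcomp expands_converse)
          qed
          show "\<forall>J. J \<subseteq> I - {j} \<and> J \<noteq> {} \<longrightarrow>
             4 * p * card J + 4 * p \<le> 4 * p * card (s' ` J \<union> t' ` J) + sum l' J"
          proof (intro allI impI)
            fix J assume J: "J \<subseteq> I - {j} \<and> J \<noteq> {}"
            then have finJ: "finite J" "j \<notin> J"
              using fin finite_subset by auto
            show "4 * p * card J + 4 * p \<le> 4 * p * card (s' ` J \<union> t' ` J) + sum l' J"
            proof (cases "i \<in> J")
              case False
              then have "s' ` J = s ` J" "t' ` J = t ` J" "sum l' J = sum l J"
                by (auto simp: s'_def t'_def l'_def intro!: sum.cong)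
              with J sparse show ?thesis
                by auto
            next
              case True
              \<comment> \<open>Compared with \<open>J\<close> in the new instance,
                \<open>insert j J\<close> in the old one has one more index, at most one more vertex
                (\<open>v\<close>) and the same total length. Its sparsity condition is thus larger
                by \<open>4p\<close> on the left and by at most \<open>4p\<close> on the
                right.\<close>
              have sub: "insert j J \<subseteq> I"
                using J iI by blast
              have "4 * p * card (insert j J) + 4 * p
                \<le> 4 * p * card (s ` insert j J \<union> t ` insert j J) + sum l (insert j J)"
                by (rule sparse[rule_format, OF conjI[OF sub insert_not_empty]])
              moreover have "s ` insert j J \<union> t ` insert j J \<subseteq> insert v (s' ` J \<union> t' ` J)"
              proof -
                have "{s i, t i} = {v, o' i}" "{s j, t j} = {v, o' j}"
                  using ends[of i] ends[of j] ij by auto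
                moreover have "s k = s' k \<and> t k = t' k" if "k \<noteq> i" for k
                  using that by (simp add: s'_def t'_def)
                moreover have "o' i = s' i" "o' j = t' i"
                  by (simp_all add: s'_def t'_def)
                ultimately have "{s k, t k} \<subseteq> insert v (s' ` J \<union> t' ` J)" if "k \<in> insert j J" for k
                  using that True by (cases "k = i"; cases "k = j") auto
                then show ?thesis
                  by auto
              qed
              then have "card (s ` insert j J \<union> t ` insert j J) \<le> card (insert v (s' ` J \<union> t' ` J))"
                using finJ by (intro card_mono) auto
              then have "card (s ` insert j J \<union> t ` insert j J) \<le> Suc (card (s' ` J \<union> t' ` J))"
                using finJ by (auto simp: card_insert_if split: if_splits)
              then have "4 * p * card (s ` insert j J \<union> t ` insert j J) \<le> 4 * p * Suc (card (s' ` J \<union> t' ` J))"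
                by (rule mult_le_mono2)
              moreover have "sum l' J = sum l (insert j J)"
              proof -
                have "sum l' J = l' i + sum l' (J - {i})"
                  using True finJ by (metis sum.remove)
                also have "sum l' (J - {i}) = sum l (J - {i})"
                  by (rule sum.cong) (auto simp: l'_def)
                finally show ?thesis
                  using True finJ by (simp add: l'_def sum.remove[of J i l])
              qed
              ultimately show ?thesis
                using finJ by simp
            qed
          qed
        qed (use fin in auto)
        then obtain c where c: "\<forall>v. c v \<in> C" "\<forall>k\<in>I - {j}. (c (s' k), c (t' k)) \<in> R' k"
          by blast
        have "(c (s' i), c (t' i)) \<in> R' i"
          using c(2) iI ij by blast
        then have "(c (o' i), c (o' j)) \<in> Q i O (Q j)\<inverse>"
          by (simp add: s'_def t'_def R'_def)
        then obtain a where a: "(c (o' i), a) \<in> Q i" "(c (o' j), a) \<in> Q j"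
          by auto
        have "a \<in> C"
          using a expands_subset[OF Qex[of i]] ij by auto
        moreover have "\<forall>k\<in>I - D. (c (s k), c (t k)) \<in> R k"
        proof
          fix k assume "k \<in> I - D"
          then show "(c (s k), c (t k)) \<in> R k"
            using c(2)[rule_format, of k] ij by (simp add: s'_def t'_def R'_def)
        qed
        ultimately show ?thesis
          using extend[of c a] c a ij by auto
      next
        case False
        with \<open>card D < 4\<close> D have cardD: "card D = 1 \<or> card D = 3"
          using card_gt_0_iff[of D] by linarith
        \<comment> \<open>At degree one the single term is at most \<open>2p\<close>; at degree
          three the bound \<open>8p\<close> on the weights drops by \<open>2p\<close> per
          index.\<close>
        have few: "(\<Sum>i\<in>D. 2 * p - l i) < 2 * p + 1"
          using cardD
        proof
          assume "card D = 1"
          then obtain i where "D = {i}"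
            by (auto simp: card_1_singleton_iff)
          then show ?thesis
            by simp
        next
          assume 3: "card D = 3"
          have "(\<Sum>i\<in>D. 4 * p - l i) = (\<Sum>i\<in>D. (2 * p - l i) + 2 * p)"
            by (rule sum.cong) (use short D in force)+
          also have "\<dots> = (\<Sum>i\<in>D. 2 * p - l i) + 6 * p"
            using 3 by (simp add: sum.distrib)
          finally show ?thesis
            using light by (simp add: D_def)
        qed
        have "\<exists>c. (\<forall>v. c v \<in> C) \<and> (\<forall>i\<in>I - D. (c (s i), c (t i)) \<in> R i)"
        proof (rule less.hyps)
          show "card (I - D) < card I"
            using fin D by (intro psubset_card_mono) auto
        qed (use fin ex sparse in auto)
        then obtain c where c: "\<forall>v. c v \<in> C" "\<forall>i\<in>I - D. (c (s i), c (t i)) \<in> R i"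
          by blast
        define bad where "bad i = C - Q i `` {c (o' i)}" for i
        have "card (bad i) \<le> 2 * p - l i" if i: "i \<in> D" for i
        proof -
          have "min (card {c (o' i)} + l i) (card C) \<le> card (Q i `` {c (o' i)})"
            by (rule expands_card_Image[OF Qex[OF i]]) (use c in auto)
          then have "Suc (l i) \<le> card (Q i `` {c (o' i)})"
            using short[of i] i D C by auto
          moreover have "Q i `` {c (o' i)} \<subseteq> C"
            using expands_subset[OF Qex[OF i]] by auto
          moreover then have "card (bad i) = card C - card (Q i `` {c (o' i)})"
            unfolding bad_def using C by (intro card_Diff_subset) (auto dest: finite_subset)
          ultimately show ?thesis
            using C by simp
        qed
        then have "card (\<Union>i\<in>D. bad i) \<le> (\<Sum>i\<in>D. 2 * p - l i)"
          using card_UN_le[OF D(2), of bad] by (meson order_trans sum_mono)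
        with few have "card (\<Union>i\<in>D. bad i) < card C"
          using C by simp
        moreover have "finite (\<Union>i\<in>D. bad i)"
          using C D by (simp add: bad_def)
        ultimately have "\<not> C \<subseteq> (\<Union>i\<in>D. bad i)"
          by (meson card_mono not_le)
        then obtain a where a: "a \<in> C" "\<forall>i\<in>D. (c (o' i), a) \<in> Q i"
          by (auto simp: bad_def)
        show ?thesis
          by (rule extend[OF c a])
      qed
    qed
  qed
qed

section \<open>Walecki's decomposition\<close>

text \<open>For permutations of a finite nonempty \<open>C\<close> this says that the inverse of
  \<open>\<sigma>\<close> composed with \<open>\<tau>\<close> is a single cycle. Comparing images
  avoids writing the inverse.\<close>

definition cyclic_pair :: "'c set \<Rightarrow> ('c \<Rightarrow> 'c) \<Rightarrow> ('c \<Rightarrow> 'c) \<Rightarrow> bool" where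
  "cyclic_pair C \<sigma> \<tau> \<longleftrightarrow> (\<forall>A. A \<subseteq> C \<and> A \<noteq> {} \<and> \<sigma> ` A = \<tau> ` A \<longrightarrow> A = C)"

text \<open>\<open>gen\<close> asks that the orbit of \<open>a\<close> under the map from
  \<open>\<sigma> x\<close> to \<open>\<tau> x\<close> fill \<open>C\<close>. If \<open>A\<close>
  has the same image under both permutations, this image and its complement are closed under that
  map, and the one that contains \<open>a\<close> is everything.\<close>

lemma cyclic_pairI:
  assumes fin: "finite C" and \<sigma>: "bij_betw \<sigma> C C" and \<tau>: "bij_betw \<tau> C C" and a: "a \<in> C"
    and gen: "\<And>D. D \<subseteq> C \<Longrightarrow> \<forall>x\<in>C. \<sigma> x \<in> D \<longrightarrow> \<tau> x \<in> D \<Longrightarrow> a \<in> D \<Longrightarrow> D = C"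
  shows "cyclic_pair C \<sigma> \<tau>"
  unfolding cyclic_pair_def
proof (intro allI impI, elim conjE)
  fix A assume A: "A \<subseteq> C" "A \<noteq> {}" "\<sigma> ` A = \<tau> ` A"
  have inj: "inj_on \<sigma> C" "inj_on \<tau> C" and img: "\<sigma> ` C = C" "\<tau> ` C = C"
    using \<sigma> \<tau> by (auto simp: bij_betw_def)
  have \<sigma>A: "\<sigma> x \<in> \<sigma> ` A \<longleftrightarrow> x \<in> A" and \<tau>A: "\<tau> x \<in> \<sigma> ` A \<longleftrightarrow> x \<in> A" if "x \<in> C" for x
    using inj_on_image_mem_iff[OF inj(1) that A(1)] inj_on_image_mem_iff[OF inj(2) that A(1)] A(3) by simp_all
  have cl: "\<sigma> ` A \<subseteq> C" "\<And>x. x \<in> C \<Longrightarrow> \<tau> x \<in> C"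
    using A(1) img by blast+
  show "A = C"
  proof (cases "a \<in> \<sigma> ` A")
    case True
    then have "\<sigma> ` A = C"
      by (intro gen) (use cl \<sigma>A \<tau>A in auto)
    then have "card A = card C"
      using A inj by (metis card_image inj_on_subset)
    then show ?thesis
      using A fin by (simp add: card_subset_eq)
  next
    case False
    have "C - \<sigma> ` A = C"
      by (intro gen) (use a cl \<sigma>A \<tau>A False in auto)
    with A img show ?thesis
      by blast
  qed
qed

text \<open>Reduces claims about all offsets of the Walecki cycles to offset \<open>0\<close>:
  \<open>r\<close> cancels from an equality of images, and \<open>r'\<close> merely replaces
  \<open>A\<close> by a set of the same size.\<close>

lemma cyclic_pair_conjugate:
  assumes fin: "finite C" and r: "bij_betw r C C" and r': "bij_betw r' C C"
    and \<sigma>: "\<sigma> ` C \<subseteq> C" and \<tau>: "\<tau> ` C \<subseteq> C" and cyc: "cyclic_pair C \<sigma> \<tau>"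
    and eq: "\<And>x. x \<in> C \<Longrightarrow> \<sigma>' x = r (\<sigma> (r' x))" "\<And>x. x \<in> C \<Longrightarrow> \<tau>' x = r (\<tau> (r' x))"
  shows "cyclic_pair C \<sigma>' \<tau>'"
  unfolding cyclic_pair_def
proof (intro allI impI, elim conjE)
  fix A assume A: "A \<subseteq> C" "A \<noteq> {}" "\<sigma>' ` A = \<tau>' ` A"
  have r'A: "r' ` A \<subseteq> C" "r' ` A \<noteq> {}"
    using A r' by (auto simp: bij_betw_def)
  have "\<sigma>' ` A = r ` \<sigma> ` r' ` A" "\<tau>' ` A = r ` \<tau> ` r' ` A"
    using A eq by (auto simp: image_image subset_iff intro!: image_cong)
  with A have "r ` \<sigma> ` r' ` A = r ` \<tau> ` r' ` A"
    by simp
  then have "\<sigma> ` r' ` A = \<tau> ` r' ` A"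
    using r r'A \<sigma> \<tau> by (subst (asm) inj_on_image_eq_iff[of r C]) (auto simp: bij_betw_def)
  then have "r' ` A = C"
    using cyc r'A unfolding cyclic_pair_def by blast
  then have "card A = card C"
    using A r' by (metis bij_betw_def card_image inj_on_subset)
  then show "A = C"
    using A fin by (simp add: card_subset_eq)
qed

text \<open>The two images of \<open>A\<close> have as many elements as \<open>A\<close>, so their
  union is larger unless they coincide, which happens only for \<open>A = C\<close>. The two
  preimages are compared in the same way.\<close>

lemma expands_cyclic_pair:
  assumes fin: "finite C" and \<sigma>: "bij_betw \<sigma> C C" and \<tau>: "bij_betw \<tau> C C" and cyc: "cyclic_pair C \<sigma> \<tau>"
    and R: "R = (\<lambda>x. (x, \<sigma> x)) ` C \<union> (\<lambda>x. (x, \<tau> x)) ` C"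
  shows "expands C 1 R"
proof -
  have inj: "inj_on \<sigma> C" "inj_on \<tau> C" and img: "\<sigma> ` C = C" "\<tau> ` C = C"
    using \<sigma> \<tau> by (auto simp: bij_betw_def)
  have RA: "R `` A = \<sigma> ` A \<union> \<tau> ` A" if "A \<subseteq> C" for A
    using that unfolding R by blast
  have RC: "R\<inverse> `` A = {x \<in> C. \<sigma> x \<in> A} \<union> {x \<in> C. \<tau> x \<in> A}" for A
    unfolding R by blast
  have key: "card A + 1 \<le> card (X \<union> Y)"
    if "finite A" "finite X" "finite Y" "card X = card A" "card Y = card A" "X \<noteq> Y" for A X Y :: "'a set"
  proof (rule ccontr)
    assume "\<not> ?thesis"
    then have "card (X \<union> Y) \<le> card X" "card (X \<union> Y) \<le> card Y"
      using that by auto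
    then have "X = X \<union> Y" "Y = X \<union> Y"
      using that by (intro card_seteq; auto)+
    with that show False
      by blast
  qed
  have "min (card A + 1) (card C) \<le> card (R `` A) \<and> min (card A + 1) (card C) \<le> card (R\<inverse> `` A)"
    if A: "A \<subseteq> C" "A \<noteq> {}" for A
  proof (cases "A = C")
    case True
    have "R `` A = C" "R\<inverse> `` A = C"
      using True img by (auto simp: RA RC)
    then show ?thesis
      by simp
  next
    case False
    have finA: "finite A"
      using A fin finite_subset by blast
    have "R `` A = \<sigma> ` A \<union> \<tau> ` A"
      using A(1) by (rule RA)
    moreover have "card A + 1 \<le> card (\<sigma> ` A \<union> \<tau> ` A)"
      using A False finA cyc inj
      by (intro key) (auto simp: cyclic_pair_def card_image intro: card_image inj_on_subset)
    moreover define X Y where "X = {x \<in> C. \<sigma> x \<in> A}" and "Y = {x \<in> C. \<tau> x \<in> A}"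
    have XY: "\<sigma> ` X = A" "\<tau> ` Y = A" "X \<subseteq> C" "Y \<subseteq> C"
      using A img by (auto simp: X_def Y_def)
    have "card A + 1 \<le> card (X \<union> Y)"
    proof (rule key)
      show "card X = card A" "card Y = card A"
        using XY inj by (metis card_image inj_on_subset)+
      show "X \<noteq> Y"
      proof
        assume "X = Y"
        then have "X = C"
          using cyc XY A unfolding cyclic_pair_def by (metis image_empty)
        with XY img False show False
          by simp
      qed
    qed (use XY fin finA in \<open>auto intro: finite_subset\<close>)
    moreover have "R\<inverse> `` A = X \<union> Y"
      by (simp add: RC X_def Y_def)
    ultimately show ?thesis
      by (simp add: min.coboundedI1)
  qed
  moreover have "R \<subseteq> C \<times> C"
    using R img by auto
  ultimately show ?thesis
    unfolding expands_def by blast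
qed

text \<open>An undirected cycle is the pair of \<open>\<sigma>\<close> and its inverse, and these
  map \<open>A\<close> to the same set only if the square of \<open>\<sigma>\<close> maps
  \<open>A\<close> to itself. The square of a cycle of odd length, here \<open>2p + 1\<close>, is
  again a single cycle.\<close>

lemma expands_cyclic_sym:
  assumes fin: "finite C" and \<sigma>: "bij_betw \<sigma> C C" and cyc: "cyclic_pair C id (\<sigma> \<circ> \<sigma>)"
    and R: "R = (\<lambda>x. (x, \<sigma> x)) ` C \<union> (\<lambda>x. (\<sigma> x, x)) ` C"
  shows "expands C 1 R"
proof (rule expands_cyclic_pair[OF fin \<sigma>])
  let ?\<tau> = "inv_into C \<sigma>"
  show \<tau>: "bij_betw ?\<tau> C C"
    using \<sigma> by (rule bij_betw_inv_into)
  have inv: "\<sigma> (?\<tau> x) = x" "?\<tau> (\<sigma> x) = x" if "x \<in> C" for x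
    using \<sigma> that by (auto simp: bij_betw_def f_inv_into_f)
  show "cyclic_pair C \<sigma> ?\<tau>"
    unfolding cyclic_pair_def
  proof (intro allI impI, elim conjE)
    fix A assume A: "A \<subseteq> C" "A \<noteq> {}" "\<sigma> ` A = ?\<tau> ` A"
    then have "\<sigma> ` \<sigma> ` A = \<sigma> ` ?\<tau> ` A"
      by simp
    also have "\<dots> = A"
    proof -
      have "\<sigma> ` ?\<tau> ` A = (\<lambda>x. x) ` A"
        unfolding image_image using A inv by (intro image_cong) auto
      then show ?thesis
        by simp
    qed
    finally have "id ` A = (\<sigma> \<circ> \<sigma>) ` A"
      by (simp add: image_comp)
    with A(1,2) show "A = C"
      by (intro cyc[unfolded cyclic_pair_def, rule_format] conjI)
  qed
  have "(\<lambda>x. (\<sigma> x, x)) ` C = (\<lambda>x. (x, ?\<tau> x)) ` C"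
  proof -
    have "(\<lambda>x. (x, ?\<tau> x)) ` C = (\<lambda>x. (x, ?\<tau> x)) ` \<sigma> ` C"
      using \<sigma> by (simp add: bij_betw_def)
    also have "\<dots> = (\<lambda>x. (\<sigma> x, x)) ` C"
      using inv by (auto simp: image_image)
    finally show ?thesis ..
  qed
  then show "R = (\<lambda>x. (x, \<sigma> x)) ` C \<union> (\<lambda>x. (x, ?\<tau> x)) ` C"
    using R by simp
qed

section \<open>Rotations of a zigzag Hamiltonian cycle\<close>

definition rot :: "int \<Rightarrow> int \<Rightarrow> int \<Rightarrow> int" where
  "rot p i x = (if x = 2 * p then 2 * p else (x + i) mod (2 * p))"

text \<open>Successor map of the cycle \<open>2p, 0, 1, 2p-1, 2, 2p-2, ..., p-1, p+1, p\<close>,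
  with \<open>2p\<close> as infinity: modulo \<open>2p\<close>, a residue \<open>x\<close> strictly
  between \<open>0\<close> and \<open>p\<close> is followed by \<open>-x\<close>, and one beyond
  \<open>p\<close> by \<open>1 - x\<close>.\<close>

definition zigzag :: "int \<Rightarrow> int \<Rightarrow> int" where
  "zigzag p x =
     (if x = 2 * p then 0 else if x = p then 2 * p else if x = 0 then 1
      else if x < p then 2 * p - x else 2 * p + 1 - x)"

text \<open>
  Walecki's decomposition of the complete graph on \<open>2p + 1\<close> vertices into \<open>p\<close> Hamiltonian cycles:
  \<open>2p\<close> plays the role of \<open>\<infinity>\<close>, the other vertices are the residues modulo \<open>2p\<close>, and
  \<open>walecki p i\<close> is the successor map of the \<open>i\<close>-th cycle
  \<open>\<infinity>, i, i + 1, i - 1, i + 2, i - 2, \<dots>, i + p\<close>.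
\<close>
definition walecki :: "int \<Rightarrow> int \<Rightarrow> int \<Rightarrow> int" where
  "walecki p i x = rot p i (zigzag p (rot p (- i) x))"

context
  fixes p :: int
  assumes p: "p \<ge> 2"
begin

lemma mod_range: "0 \<le> y mod (2 * p)" "y mod (2 * p) < 2 * p"
  using p by simp_all

lemma rot_in: "x \<in> {0..2*p} \<Longrightarrow> rot p i x \<in> {0..2*p}"
  using mod_range[of "x + i"] p by (auto simp: rot_def intro: less_imp_le)

lemma rot_rot: "rot p i (rot p j x) = rot p (i + j) x"
  using mod_range[of "x + j"] mod_add_left_eq[of "x + j" "2 * p" i] by (auto simp: rot_def add.assoc add.commute[of i])

lemma rot_0: "x \<in> {0..2*p} \<Longrightarrow> rot p 0 x = x"
  by (auto simp: rot_def)

lemma bij_rot: "bij_betw (rot p i) {0..2*p} {0..2*p}"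
  by (rule bij_betw_byWitness[where f' = "rot p (- i)"]) (auto simp: rot_rot rot_0 simp del: atLeastAtMost_iff intro!: rot_in)

lemma zigzag_in: "x \<in> {0..2*p} \<Longrightarrow> zigzag p x \<in> {0..2*p}"
  using p by (auto simp: zigzag_def)

lemma bij_zigzag: "bij_betw (zigzag p) {0..2*p} {0..2*p}"
proof -
  have "inj_on (zigzag p) {0..2*p}"
    using p by (auto simp: inj_on_def zigzag_def split: if_splits)
  then show ?thesis
    using zigzag_in by (intro bij_betw_imageI endo_inj_surj) auto
qed

lemma walecki_in: "x \<in> {0..2*p} \<Longrightarrow> walecki p i x \<in> {0..2*p}"
  unfolding walecki_def by (intro rot_in zigzag_in)

lemma bij_walecki: "bij_betw (walecki p i) {0..2*p} {0..2*p}"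
proof -
  have "bij_betw (rot p i \<circ> (zigzag p \<circ> rot p (- i))) {0..2*p} {0..2*p}"
    by (rule bij_betw_trans[OF bij_betw_trans[OF bij_rot bij_zigzag] bij_rot])
  then show ?thesis
    by (simp add: walecki_def[abs_def] comp_def)
qed

lemma walecki_1:
  assumes "x \<in> {0..2*p}"
  shows "walecki p 1 x =
    (if x = 2 * p then 1 else if x = p + 1 then 2 * p else if x = 1 then 2 else if x = 0 then 3
     else if x = 2 then 0 else if x \<le> p then 2 * p + 2 - x else 2 * p + 3 - x)"
proof -
  have "rot p (- 1) x = (if x = 2 * p then 2 * p else if x = 0 then 2 * p - 1 else x - 1)"
    using assms p by (auto simp: rot_def zmod_minus1)
  moreover have "rot p 1 y = (if y = 2 * p then 2 * p else if y = 2 * p - 1 then 0 else y + 1)" if "y \<in> {0..2*p}" for y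
    using that p by (auto simp: rot_def)
  moreover have "walecki p 1 x = rot p 1 (zigzag p (rot p (- 1) x))"
    by (simp add: walecki_def)
  ultimately show ?thesis
    using zigzag_in[OF rot_in[OF assms]] assms p by (auto simp: zigzag_def)
qed

text \<open>Two steps of the zigzag at a time visit
  \<open>1, 2, ..., p, 0, 2p-1, 2p-2, ..., p+1, 2p\<close>, which is everything.\<close>

lemma cyclic_zigzag_square: "cyclic_pair {0..2*p} id (zigzag p \<circ> zigzag p)"
proof (rule cyclic_pairI[where a = 1])
  show "bij_betw (zigzag p \<circ> zigzag p) {0..2*p} {0..2*p}"
    using bij_zigzag by (rule bij_betw_trans) (rule bij_zigzag)
  fix D assume D: "D \<subseteq> {0..2*p}" "1 \<in> D"
    and "\<forall>x\<in>{0..2*p}. id x \<in> D \<longrightarrow> (zigzag p \<circ> zigzag p) x \<in> D"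
  then have step: "zigzag p (zigzag p x) \<in> D" if "x \<in> D" for x
    using that by auto
  have up: "x \<le> p \<longrightarrow> x \<in> D" if "1 \<le> x" for x
    using that
  proof (induction rule: int_ge_induct)
    case (step x)
    then show ?case
      using \<open>1 \<in> D\<close> \<open>\<And>x. x \<in> D \<Longrightarrow> zigzag p (zigzag p x) \<in> D\<close>[of x] p by (auto simp: zigzag_def algebra_simps)
  qed (use D in simp)
  have 0: "0 \<in> D"
    using step[of p] up[of p] p by (simp add: zigzag_def)
  have "2 * p - 1 \<in> D"
    using step[OF 0] p by (auto simp: zigzag_def split: if_splits)
  have down: "p < x \<longrightarrow> x \<in> D" if "x \<le> 2 * p - 1" for x
    using that
  proof (induction rule: int_le_induct)
    case (step x)
    then show ?case
      using \<open>\<And>x. x \<in> D \<Longrightarrow> zigzag p (zigzag p x) \<in> D\<close>[of x] p by (auto simp: zigzag_def split: if_splits)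
  qed (use \<open>2 * p - 1 \<in> D\<close> in simp)
  have "2 * p \<in> D"
    using step[of "p + 1"] down[of "p + 1"] p by (auto simp: zigzag_def split: if_splits)
  then have "x \<in> D" if "x \<in> {0..2*p}" for x
    using that 0 up[of x] down[of x] by (cases "x = 0"; cases "x = 2 * p"; cases "x \<le> p") auto
  with D show "D = {0..2*p}"
    by blast
qed (use p in auto)

text \<open>The map from \<open>zigzag p x\<close> to \<open>walecki p 1 x\<close> mostly adds
  \<open>2\<close>. Its orbit is \<open>1, 3, ..., 2p-1, 2, 4, ..., p, 2p, p+2, ..., 2p-2, 0\<close>
  for even \<open>p\<close> and \<open>1, 3, ..., p, 2p, p+2, ..., 2p-1, 2, 4, ..., 2p-2, 0\<close>
  for odd \<open>p\<close>. The facts \<open>c1\<close> to \<open>c4\<close> are the jumps.\<close>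

lemma cyclic_zigzag_walecki: "cyclic_pair {0..2*p} (zigzag p) (walecki p 1)"
proof (rule cyclic_pairI[where a = 1])
  fix D assume D: "D \<subseteq> {0..2*p}" "1 \<in> D"
    and "\<forall>x\<in>{0..2*p}. zigzag p x \<in> D \<longrightarrow> walecki p 1 x \<in> D"
  then have step: "walecki p 1 x \<in> D" if "x \<in> {0..2*p}" "zigzag p x \<in> D" for x
    using that by auto
  have low: "x + 2 \<in> D" if "x \<in> D" "1 \<le> x" "x < p" for x
    using step[of 0] step[of "2 * p + 1 - x"] that p
    by (cases "x = 1") (auto simp: walecki_1 zigzag_def add.commute split: if_splits)
  have high: "x + 2 \<in> D" if "x \<in> D" "p < x" "x < 2 * p - 2" for x
    using step[of "2 * p - x"] that p by (auto simp: walecki_1 zigzag_def add.commute split: if_splits)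
  have c1: "0 \<in> D" if "2 * p - 2 \<in> D" "p > 2"
    using step[of 2] that p by (auto simp: walecki_1 zigzag_def split: if_splits)
  have c2: "2 \<in> D" if "2 * p - 1 \<in> D"
    using step[of 1] that p by (auto simp: walecki_1 zigzag_def split: if_splits)
  have c3: "2 * p \<in> D" if "p \<in> D"
    using step[of "p + 1"] that p by (auto simp: walecki_1 zigzag_def split: if_splits)
  have c4: "if p = 2 then 0 \<in> D else p + 2 \<in> D" if "2 * p \<in> D"
    using step[of p] that p by (auto simp: walecki_1 zigzag_def split: if_splits)
  have lows: "y \<in> D" if "x \<in> D" "1 \<le> x" "x \<le> y" "y \<le> p + 1" "even (y - x)" for x y
  proof -
    have k: "x + 2 * int k \<le> p + 1 \<longrightarrow> x + 2 * int k \<in> D" for k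
      by (induction k) (use low[of "x + 2 * int k" for k] that in \<open>auto simp: algebra_simps\<close>)
    have "y = x + 2 * int (nat ((y - x) div 2))"
      using that by simp
    then show ?thesis
      using k that by metis
  qed
  have highs: "y \<in> D" if "x \<in> D" "p < x" "x \<le> y" "y < 2 * p" "even (y - x)" for x y
  proof -
    have k: "x + 2 * int k < 2 * p \<longrightarrow> x + 2 * int k \<in> D" for k
      by (induction k) (use high[of "x + 2 * int k" for k] that in \<open>auto simp: algebra_simps\<close>)
    have "y = x + 2 * int (nat ((y - x) div 2))"
      using that by simp
    then show ?thesis
      using k that by metis
  qed
  have odds: "y \<in> D" if "1 \<le> y" "y \<le> p + 1" "odd y" for y
    using lows[of 1 y] D(2) that by simp
  have all: "(\<forall>y. p < y \<and> y < 2 * p \<longrightarrow> y \<in> D) \<and> 0 \<in> D \<and> 2 * p \<in> D \<and> 2 \<in> D"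
  \<comment> \<open>The residues of the parity of \<open>p\<close> pass the middle by the detour
    through \<open>2p\<close>, the others through \<open>p + 1\<close>.\<close>
  proof (cases "even p")
    case True
    have odd_high: "y \<in> D" if "p < y" "y < 2 * p" "odd y" for y
      using highs[of "p + 1" y] odds[of "p + 1"] that True p by simp
    have 2: "2 \<in> D"
      using c2 odd_high[of "2 * p - 1"] p by simp
    have top: "2 * p \<in> D"
      using c3 lows[OF 2, of p] True p by simp
    have even_high: "y \<in> D" if "p < y" "y < 2 * p" "even y" for y
      using highs[of "p + 2" y] c4[OF top] that True by (auto split: if_splits elim!: evenE)
    have "0 \<in> D"
      using c1 c4[OF top] even_high[of "2 * p - 2"] p by (cases "p = 2") auto
    with 2 top odd_high even_high show ?thesis
      by blast
  next
    case False
    have top: "2 * p \<in> D"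
      using c3 odds[of p] False p by simp
    have p2: "p > 2"
      using p False by (cases "p = 2") auto
    have odd_high: "y \<in> D" if "p < y" "y < 2 * p" "odd y" for y
    proof -
      have "y \<noteq> p + 1"
        using that False by auto
      then show ?thesis
        using highs[of "p + 2" y] c4[OF top] that False p2 by auto
    qed
    have 2: "2 \<in> D"
      using c2 odd_high[of "2 * p - 1"] p2 by simp
    have even_high: "y \<in> D" if "p < y" "y < 2 * p" "even y" for y
      using highs[of "p + 1" y] lows[OF 2, of "p + 1"] that False p2 by simp
    have "0 \<in> D"
      using c1 even_high[of "2 * p - 2"] p2 by simp
    with 2 top odd_high even_high show ?thesis
      by blast
  qed
  have "x \<in> D" if "x \<in> {0..2*p}" for x
  proof -
    have "x = 0 \<or> x = 2 * p \<or> p < x \<and> x < 2 * p \<or> 1 \<le> x \<and> x \<le> p \<and> odd x \<or> 2 \<le> x \<and> x \<le> p \<and> even x"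
      using that by (cases "x = 1") auto
    then show ?thesis
      using all odds[of x] lows[of 2 x] by (elim disjE) auto
  qed
  with D show "D = {0..2*p}"
    by blast
qed (use p bij_zigzag bij_walecki in auto)

lemma expands_walecki_sym:
  "expands {0..2*p} 1 ((\<lambda>x. (x, walecki p i x)) ` {0..2*p} \<union> (\<lambda>x. (walecki p i x, x)) ` {0..2*p})"
proof (rule expands_cyclic_sym[OF _ bij_walecki _ refl])
  show "cyclic_pair {0..2*p} id (walecki p i \<circ> walecki p i)"
  proof (rule cyclic_pair_conjugate[OF _ bij_rot bij_rot _ _ cyclic_zigzag_square])
    fix x assume x: "x \<in> {0..2*p}"
    show "id x = rot p i (id (rot p (- i) x))"
      using x by (simp add: rot_rot rot_0)
    show "(walecki p i \<circ> walecki p i) x = rot p i ((zigzag p \<circ> zigzag p) (rot p (- i) x))"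
      using zigzag_in[OF rot_in[OF x]] by (simp add: walecki_def rot_rot rot_0)
  qed (use zigzag_in in \<open>auto simp del: atLeastAtMost_iff\<close>)
qed auto

lemma expands_walecki_arcs:
  "expands {0..2*p} 1 ((\<lambda>x. (x, walecki p i x)) ` {0..2*p} \<union> (\<lambda>x. (x, walecki p (i + 1) x)) ` {0..2*p})"
proof (rule expands_cyclic_pair[OF _ bij_walecki bij_walecki _ refl])
  show "cyclic_pair {0..2*p} (walecki p i) (walecki p (i + 1))"
  proof (rule cyclic_pair_conjugate[OF _ bij_rot bij_rot _ _ cyclic_zigzag_walecki])
    fix x assume x: "x \<in> {0..2*p}"
    show "walecki p i x = rot p i (zigzag p (rot p (- i) x))"
      by (simp add: walecki_def)
    show "walecki p (i + 1) x = rot p i (walecki p 1 (rot p (- i) x))"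
      by (simp add: walecki_def rot_rot add.commute)
  qed (use zigzag_in walecki_in in \<open>auto simp del: atLeastAtMost_iff\<close>)
qed auto

lemma zigzag_no_2_cycle:
  assumes "x \<in> {0..2*p}"
  shows "zigzag p x \<noteq> x" "zigzag p (zigzag p x) \<noteq> x"
  using assms p by (auto simp: zigzag_def)

lemma walecki_no_2_cycle:
  assumes x: "x \<in> {0..2*p}"
  shows "walecki p i x \<noteq> x" "walecki p i (walecki p i x) \<noteq> x"
proof -
  have *: "rot p i y \<noteq> x" if "y \<noteq> rot p (- i) x" "y \<in> {0..2*p}" for y
  proof
    assume "rot p i y = x"
    then have "rot p (- i) x = rot p (- i) (rot p i y)"
      by simp
    with that show False
      by (simp add: rot_rot rot_0)
  qed
  show "walecki p i x \<noteq> x"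
    unfolding walecki_def
    by (intro * zigzag_no_2_cycle rot_in zigzag_in x)
  have "walecki p i (walecki p i x) = rot p i (zigzag p (zigzag p (rot p (- i) x)))"
    using zigzag_in[OF rot_in[OF x]] by (simp add: walecki_def rot_rot rot_0)
  also have "\<dots> \<noteq> x"
    by (intro * zigzag_no_2_cycle rot_in zigzag_in x)
  finally show "walecki p i (walecki p i x) \<noteq> x" .
qed

text \<open>Consecutive finite vertices of the \<open>i\<close>-th cycle have sum \<open>2i\<close> or \<open>2i + 1\<close> modulo \<open>2p\<close>.\<close>
definition walecki_colour :: "int \<Rightarrow> int \<Rightarrow> int" where
  "walecki_colour x y =
     (if x = 2 * p then y mod p else if y = 2 * p then x mod p else ((x + y) mod (2 * p)) div 2)"

lemma walecki_colour_commute: "x \<noteq> y \<Longrightarrow> walecki_colour x y = walecki_colour y x"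
  by (simp add: walecki_colour_def add.commute)

lemma walecki_colour:
  assumes x: "x \<in> {0..2*p}" and i: "0 \<le> i" "i < p"
  shows "walecki_colour x (walecki p i x) = i"
proof (cases "x = 2 * p")
  case True
  then show ?thesis
    using i p by (simp add: walecki_colour_def walecki_def rot_def zigzag_def)
next
  case False
  define r where "r = (x - i) mod (2 * p)"
  have r: "0 \<le> r" "r < 2 * p"
    using mod_range[of "x - i"] by (simp_all add: r_def)
  have w: "walecki p i x = rot p i (zigzag p r)"
    using False by (simp add: walecki_def rot_def r_def)
  show ?thesis
  \<comment> \<open>\<open>r = p\<close> is the vertex before infinity: there \<open>x\<close> is
    congruent to \<open>i + p\<close> modulo \<open>2p\<close>, hence to \<open>i\<close> modulo
    \<open>p\<close>.\<close>
  proof (cases "r = p")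
    case True
    then have "(x - i) mod (2 * p) = p mod (2 * p)"
      using p by (simp add: r_def)
    then have "2 * p dvd x - i - p"
      by (simp only: mod_eq_dvd_iff)
    then have "p dvd x - i - p"
      by (rule dvd_mult_right)
    then have "p dvd x - i"
      using dvd_add[of p "x - i - p" p] by simp
    then have "x mod p = i"
      using i by (metis mod_eq_dvd_iff mod_pos_pos_trivial)
    with True False p show ?thesis
      by (simp add: w walecki_colour_def rot_def zigzag_def)
  next
    case False
    then have "zigzag p r \<noteq> 2 * p"
      using r p by (auto simp: zigzag_def)
    then have w': "walecki p i x = (zigzag p r + i) mod (2 * p)"
      by (simp add: w rot_def)
    have "(x + walecki p i x) mod (2 * p) = ((x - i) + zigzag p r + 2 * i) mod (2 * p)"
      unfolding w' by (simp add: mod_add_right_eq algebra_simps)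
    also have "\<dots> = (r + zigzag p r + 2 * i) mod (2 * p)"
      unfolding r_def add.assoc by (rule mod_add_left_eq[symmetric])
    also have "\<dots> = (if r = 0 \<or> p < r then 2 * i + 1 else 2 * i)"
      using r False i p mod_add_self1[of "2 * p" "2 * i + 1"] by (auto simp: zigzag_def add.assoc add.commute[of 1])
    finally have "(x + walecki p i x) mod (2 * p) div 2 = i"
      by simp
    moreover have "walecki p i x \<noteq> 2 * p"
      using mod_range[of "zigzag p r + i"] by (simp add: w')
    ultimately show ?thesis
      using \<open>x \<noteq> 2 * p\<close> by (simp add: walecki_colour_def)
  qed
qed

text \<open>\<open>walecki_colour\<close> recovers the cycle from the unordered pair, and the
  orientation follows because a successor map has no 2-cycle. This makes the target a legal
  graph.\<close>

lemma walecki_edge_disjoint: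
  assumes x: "x \<in> {0..2*p}" and y: "y \<in> {0..2*p}" and i: "0 \<le> i" "i < p" and j: "0 \<le> j" "j < p"
    and eq: "{x, walecki p i x} = {y, walecki p j y}"
  shows "x = y \<and> i = j"
proof -
  have ij: "i = j"
  proof (cases "x = y")
    case True
    with eq have "walecki p i x = walecki p j y"
      using walecki_no_2_cycle(1)[OF x, of i] walecki_no_2_cycle(1)[OF y, of j] by (auto simp: doubleton_eq_iff)
    with True show ?thesis
      using walecki_colour[OF x i] walecki_colour[OF y j] by metis
  next
    case False
    with eq have "x = walecki p j y" "walecki p i x = y"
      by (auto simp: doubleton_eq_iff)
    with False show ?thesis
      using walecki_colour[OF x i] walecki_colour[OF y j] walecki_colour_commute[of x y] by metis
  qed
  with eq show ?thesis
    using walecki_no_2_cycle(2)[OF y, of j] by (auto simp: doubleton_eq_iff)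
qed

end

section \<open>Cycles and forests\<close>

fun path_edges :: "'v list \<Rightarrow> 'v set set" where
  "path_edges (x # y # zs) = insert {x, y} (path_edges (y # zs))"
| "path_edges _ = {}"

text \<open>The closing edge is kept apart from the path because faces are split below by adding one
  edge to a path already drawn.\<close>

definition cycle_in :: "'v set set \<Rightarrow> 'v list \<Rightarrow> bool" where
  "cycle_in F xs \<longleftrightarrow> length xs \<ge> 3 \<and> distinct xs \<and> path_edges xs \<subseteq> F \<and> {last xs, hd xs} \<in> F"

definition acyclic_edges :: "'v set set \<Rightarrow> bool" where
  "acyclic_edges F \<longleftrightarrow> (\<forall>xs. \<not> cycle_in F xs)"

lemma path_edges_append:
  "xs \<noteq> [] \<Longrightarrow> ys \<noteq> [] \<Longrightarrow>
     path_edges (xs @ ys) = insert {last xs, hd ys} (path_edges xs \<union> path_edges ys)"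
proof (induction xs rule: path_edges.induct)
  case (1 x y zs)
  then show ?case by auto
next
  case ("2_2" v)
  then show ?case by (cases ys) auto
qed auto

lemma path_edges_append_subset: "path_edges xs \<subseteq> path_edges (xs @ ys)"
  by (cases "xs = []"; cases "ys = []") (auto simp: path_edges_append)

lemma path_edges_subset: "e \<in> path_edges xs \<Longrightarrow> e \<subseteq> set xs"
  by (induction xs rule: path_edges.induct) auto

lemma Union_path_edges: "length xs \<ge> 2 \<Longrightarrow> \<Union> (path_edges xs) = set xs"
proof (induction xs rule: path_edges.induct)
  case (1 x y zs)
  then show ?case by (cases zs) auto
qed auto

lemma nth_in_path_edges: "Suc i < length xs \<Longrightarrow> {xs ! i, xs ! Suc i} \<in> path_edges xs"
  by (induction xs arbitrary: i rule: path_edges.induct) (auto simp: nth_Cons split: nat.splits)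

lemma path_edges_split:
  assumes "e \<in> path_edges xs"
  obtains us a b vs where "xs = us @ a # b # vs" "e = {a, b}"
  using assms
proof (induction xs arbitrary: thesis rule: path_edges.induct)
  case (1 x y zs)
  from "1.prems"(2) consider "e = {x, y}" | "e \<in> path_edges (y # zs)"
    by auto
  then show ?case
  proof cases
    case 1
    then show ?thesis using "1.prems"(1)[of "[]" x y zs] by simp
  next
    case 2
    then obtain us a b vs where "y # zs = us @ a # b # vs" "e = {a, b}"
      using "1.IH" by blast
    then show ?thesis using "1.prems"(1)[of "x # us" a b vs] by simp
  qed
qed auto

lemma finite_path_edges: "finite (path_edges xs)"
  by (induction xs rule: path_edges.induct) auto

lemma card_path_edges: "distinct xs \<Longrightarrow> card (path_edges xs) = length xs - 1"
proof (induction xs rule: path_edges.induct)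
  case (1 x y zs)
  have "{x, y} \<notin> path_edges (y # zs)"
    using path_edges_subset[of "{x, y}" "y # zs"] "1.prems" by auto
  then show ?case
    using 1 by (simp add: finite_path_edges)
qed auto

lemma closing_edge_notin_path:
  assumes "distinct xs" "length xs \<ge> 3"
  shows "{last xs, hd xs} \<notin> path_edges xs"
proof -
  obtain x y z zs where xs: "xs = x # y # z # zs"
    using assms(2) by (auto simp: numeral_3_eq_3 Suc_le_length_iff)
  have "x \<notin> set (y # z # zs)" and "last xs \<noteq> y"
    using assms(1) last_in_set[of "z # zs"] by (auto simp: xs simp del: last_in_set split: if_splits)
  then show ?thesis
    using path_edges_subset[of "{last xs, hd xs}" "y # z # zs"] by (auto simp: xs doubleton_eq_iff)
qed

lemma cycle_in_length_le:
  assumes "cycle_in F xs" "finite F"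
  shows "length xs \<le> card F"
proof -
  have xs: "distinct xs" "length xs \<ge> 3"
    using assms(1) by (auto simp: cycle_in_def)
  then have "card (insert {last xs, hd xs} (path_edges xs)) = Suc (length xs - 1)"
    by (simp only: card_insert_disjoint finite_path_edges closing_edge_notin_path card_path_edges not_False_eq_True)
  then have "card (insert {last xs, hd xs} (path_edges xs)) = length xs"
    using xs by linarith
  moreover have "insert {last xs, hd xs} (path_edges xs) \<subseteq> F"
    using assms(1) by (auto simp: cycle_in_def)
  ultimately show ?thesis
    using card_mono[OF assms(2)] by metis
qed

lemma cycle_in_mono: "cycle_in F xs \<Longrightarrow> F \<subseteq> F' \<Longrightarrow> cycle_in F' xs"
  by (auto simp: cycle_in_def)

lemma cycle_in_is_cycle:
  assumes "cycle_in F xs" "F \<subseteq> sedges S" "simple_graph S"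
  shows "is_cycle S xs"
  unfolding is_cycle_def
proof (intro conjI allI impI)
  show "length xs \<ge> 3" "distinct xs"
    using assms(1) by (auto simp: cycle_in_def)
  then have "set xs = \<Union> (path_edges xs)"
    by (simp add: Union_path_edges)
  moreover have "\<Union> (path_edges xs) \<subseteq> \<Union> (sedges S)"
    using assms(1,2) by (intro Union_mono) (auto simp: cycle_in_def)
  moreover have "\<Union> (sedges S) \<subseteq> sverts S"
    using assms(3) by (auto simp: simple_graph_def)
  ultimately show "set xs \<subseteq> sverts S"
    by simp
  fix i assume i: "i < length xs"
  show "{xs ! i, xs ! (Suc i mod length xs)} \<in> sedges S"
  proof (cases "Suc i < length xs")
    case True
    then show ?thesis
      using nth_in_path_edges[OF True] assms by (auto simp: cycle_in_def)
  next
    case False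
    then have "i = length xs - 1" "xs \<noteq> []"
      using i by auto
    then show ?thesis
      using assms by (auto simp: cycle_in_def last_conv_nth hd_conv_nth)
  qed
qed

text \<open>Cutting the list inside the chosen edge and exchanging the two pieces makes that edge
  the closing one. Needed when a new edge completes a cycle at an unknown place.\<close>

lemma cycle_in_rotate:
  assumes "cycle_in F xs" "e \<in> insert {last xs, hd xs} (path_edges xs)"
  obtains ys where "cycle_in F ys" "{last ys, hd ys} = e"
proof (cases "e \<in> path_edges xs")
  case True
  then obtain us a b vs where xs: "xs = us @ a # b # vs" "e = {a, b}"
    by (rule path_edges_split)
  have *: "path_edges (b # vs @ us @ [a]) \<subseteq> F"
  proof (cases "us = []")
    case True
    then show ?thesis
      using assms(1) path_edges_append[of "b # vs" "[a]"] by (auto simp: xs cycle_in_def split: if_splits)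
  next
    case False
    have "path_edges xs = insert {last us, a} (path_edges us \<union> path_edges (a # b # vs))"
      using path_edges_append[OF False, of "a # b # vs"] by (simp add: xs)
    moreover have "path_edges (us @ [a]) = insert {last us, a} (path_edges us)"
      using path_edges_append[OF False, of "[a]"] by simp
    moreover have "path_edges (b # vs @ us @ [a])
      = insert {last (b # vs), hd us} (path_edges (b # vs) \<union> path_edges (us @ [a]))"
      using path_edges_append[of "b # vs" "us @ [a]"] False by simp
    moreover have "{last (b # vs), hd us} \<in> F"
      using assms(1) False by (simp add: cycle_in_def xs split: if_splits)
    ultimately show ?thesis
      using assms(1) by (auto simp: cycle_in_def)
  qed
  moreover have "e \<in> F"
    using True assms(1) by (auto simp: cycle_in_def)
  ultimately have "cycle_in F (b # vs @ us @ [a])"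
    using assms(1) xs by (auto simp: cycle_in_def insert_commute)
  then show thesis
    using that xs by auto
next
  case False
  then show thesis
    using that assms by auto
qed

text \<open>\<open>v\<close> is the first vertex of a longest path: a further neighbour would either
  extend the path or, lying on it, close a cycle.\<close>

lemma acyclic_edges_leaf:
  assumes "finite F" "F \<noteq> {}" "\<forall>e\<in>F. card e = 2" "acyclic_edges F"
  obtains v w where "{v, w} \<in> F" "v \<noteq> w" "\<And>f. f \<in> F \<Longrightarrow> v \<in> f \<Longrightarrow> f = {v, w}"
proof -
  define Q where "Q xs \<longleftrightarrow> distinct xs \<and> length xs \<ge> 2 \<and> path_edges xs \<subseteq> F" for xs
  have finU: "finite (\<Union> F)"
    using assms(1,3) by (intro finite_Union) (auto intro: card_ge_0_finite)
  have bound: "length xs \<le> card (\<Union> F)" if "Q xs" for xs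
  proof -
    have "set xs \<subseteq> \<Union> F"
      using that Union_path_edges[of xs] by (auto simp: Q_def)
    then show ?thesis
      using that finU by (metis Q_def card_mono distinct_card)
  qed
  obtain a b where ab: "{a, b} \<in> F" "a \<noteq> b"
    using assms(2,3) by (metis card_2_iff ex_in_conv)
  then have "Q [a, b]"
    by (simp add: Q_def)
  then have "\<exists>xs. Q xs \<and> (\<forall>ys. Q ys \<longrightarrow> length ys \<le> length xs)"
    by (rule ex_has_greatest_nat[where b = "Suc (card (\<Union> F))"]) (use bound in \<open>auto simp: less_Suc_eq_le\<close>)
  then obtain xs where xs: "Q xs" "\<And>ys. Q ys \<Longrightarrow> length ys \<le> length xs"
    by blast
  then obtain x y zs where xs_eq: "xs = x # y # zs"
    by (auto simp: Q_def numeral_2_eq_2 Suc_le_length_iff)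
  have "f = {x, y}" if f: "f \<in> F" "x \<in> f" for f
  proof -
    obtain w where w: "f = {x, w}" "w \<noteq> x"
      using assms(3) f by (metis card_2_iff doubleton_eq_iff insertE singletonD)
    have "w \<in> set xs"
    proof (rule ccontr)
      assume "w \<notin> set xs"
      then have "Q (w # xs)"
        using xs(1) f w by (auto simp: Q_def xs_eq insert_commute)
      then show False
        using xs(2) by fastforce
    qed
    moreover have "w \<notin> set zs"
    proof
      assume "w \<in> set zs"
      then obtain us vs where zs: "zs = us @ w # vs"
        by (auto simp: in_set_conv_decomp)
      have "path_edges ((x # y # us @ [w]) @ vs) \<subseteq> F"
        using xs(1) by (simp add: Q_def xs_eq zs)
      then have "path_edges (x # y # us @ [w]) \<subseteq> F"
        using path_edges_append_subset by (rule order_trans[rotated])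
      then have "cycle_in F (x # y # us @ [w])"
        using xs(1) f w by (auto simp: cycle_in_def Q_def xs_eq zs insert_commute)
      then show False
        using assms(4) by (auto simp: acyclic_edges_def)
    qed
    ultimately show ?thesis
      using w by (auto simp: xs_eq)
  qed
  moreover have "{x, y} \<in> F" "x \<noteq> y"
    using xs(1) by (auto simp: Q_def xs_eq)
  ultimately show thesis
    using that by blast
qed

lemma acyclic_edges_subset: "acyclic_edges F \<Longrightarrow> F' \<subseteq> F \<Longrightarrow> acyclic_edges F'"
  unfolding acyclic_edges_def by (meson cycle_in_mono)

lemma card_acyclic_edges:
  assumes "finite V" "V \<noteq> {}" "\<Union> F \<subseteq> V" "finite F" "\<forall>e\<in>F. card e = 2" "acyclic_edges F"
  shows "card F + 1 \<le> card V"
  using assms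
proof (induction "card F" arbitrary: F V)
  case 0
  then show ?case
    by (simp add: Suc_leI card_gt_0_iff)
next
  case (Suc k)
  then have "F \<noteq> {}"
    by auto
  with Suc.prems obtain v w where vw: "{v, w} \<in> F" "v \<noteq> w" "\<And>f. f \<in> F \<Longrightarrow> v \<in> f \<Longrightarrow> f = {v, w}"
    by (metis acyclic_edges_leaf)
  have "card (F - {{v, w}}) + 1 \<le> card (V - {v})"
  proof (rule Suc.hyps)
    show "k = card (F - {{v, w}})"
      using Suc.hyps(2) vw(1) Suc.prems(4) by simp
    show "V - {v} \<noteq> {}"
      using vw Suc.prems(3) by blast
    show "\<Union> (F - {{v, w}}) \<subseteq> V - {v}"
      using vw(3) Suc.prems(3) by blast
    show "acyclic_edges (F - {{v, w}})"
      using Suc.prems(6) by (rule acyclic_edges_subset) auto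
  qed (use Suc.prems in auto)
  moreover have "v \<in> V"
    using vw(1) Suc.prems(3) by blast
  ultimately show ?case
    using vw(1) Suc.prems(1,4) Suc.hyps(2) by simp
qed

definition joined :: "'v set set \<Rightarrow> 'v \<Rightarrow> 'v \<Rightarrow> bool" where
  "joined F u w \<longleftrightarrow> (\<exists>xs. xs \<noteq> [] \<and> distinct xs \<and> path_edges xs \<subseteq> F \<and> hd xs = u \<and> last xs = w)"

lemma joined_refl: "joined F u u"
  unfolding joined_def by (intro exI[of _ "[u]"]) auto

lemma joined_step:
  assumes "joined F u w" "{w, w'} \<in> F"
  shows "joined F u w'"
proof -
  obtain xs where xs: "xs \<noteq> []" "distinct xs" "path_edges xs \<subseteq> F" "hd xs = u" "last xs = w"
    using assms(1) by (auto simp: joined_def)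
  show ?thesis
  proof (cases "w' \<in> set xs")
    case True
    then obtain us vs where eq: "xs = us @ w' # vs"
      by (auto simp: in_set_conv_decomp)
    have "path_edges (us @ [w']) \<subseteq> F"
      using xs(3) path_edges_append_subset[of "us @ [w']" vs] by (simp add: eq)
    then show ?thesis
      unfolding joined_def using xs by (intro exI[of _ "us @ [w']"]) (auto simp: eq hd_append)
  next
    case False
    then show ?thesis
      unfolding joined_def using xs assms(2) path_edges_append[of xs "[w']"]
      by (intro exI[of _ "xs @ [w']"]) auto
  qed
qed

lemma joined_cycle:
  assumes "joined F u v" "u \<noteq> v" "{u, v} \<notin> F"
  obtains xs where "length xs \<ge> 3" "distinct xs" "path_edges xs \<subseteq> F" "{last xs, hd xs} = {u, v}"
proof -
  obtain xs where xs: "xs \<noteq> []" "distinct xs" "path_edges xs \<subseteq> F" "hd xs = u" "last xs = v"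
    using assms(1) by (auto simp: joined_def)
  then obtain x ys where x: "xs = x # ys"
    by (cases xs) auto
  then obtain y zs where y: "ys = y # zs"
    using xs assms(2) by (cases ys) auto
  then have "zs \<noteq> []"
    using xs assms(3) x by auto
  then show thesis
    using that[of xs] xs x y by (cases zs) auto
qed

section \<open>Faces of plane graphs\<close>

locale plane_graph =
  fixes S :: "'v sgraph" and p :: "'v \<Rightarrow> complex" and \<gamma> :: "'v set \<Rightarrow> real \<Rightarrow> complex"
  assumes simple: "simple_graph S" and drawing: "plane_drawing S p \<gamma>"
begin

definition drawn :: "'v set set \<Rightarrow> complex set" where
  "drawn F = (\<Union>e\<in>F. path_image (\<gamma> e))"

text \<open>Linked points are those in a common face of the drawing of \<open>F\<close>; in
  particular they lie off the drawing.\<close>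

abbreviation linked :: "'v set set \<Rightarrow> complex \<Rightarrow> complex \<Rightarrow> bool" where
  "linked F \<equiv> connected_component (- drawn F)"

lemma edge_card: "e \<in> sedges S \<Longrightarrow> card e = 2"
  and edge_subset: "e \<in> sedges S \<Longrightarrow> e \<subseteq> sverts S"
  using simple by (auto simp: simple_graph_def)

lemma finite_edges: "F \<subseteq> sedges S \<Longrightarrow> finite F"
  using simple finite_subset[of "sedges S" "Pow (sverts S)"] finite_subset[of F "sedges S"]
  by (auto simp: simple_graph_def)

lemma inj_p: "inj_on p (sverts S)"
  using drawing by (simp add: plane_drawing_def)

lemma edge_arc: "e \<in> sedges S \<Longrightarrow> arc (\<gamma> e)"
  and edge_ends: "e \<in> sedges S \<Longrightarrow> {pathstart (\<gamma> e), pathfinish (\<gamma> e)} = p ` e"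
  and edge_vertices: "e \<in> sedges S \<Longrightarrow> path_image (\<gamma> e) \<inter> p ` sverts S = p ` e"
  using drawing by (simp_all add: plane_drawing_def)

lemma edge_Int:
  "e \<in> sedges S \<Longrightarrow> f \<in> sedges S \<Longrightarrow> e \<noteq> f \<Longrightarrow> path_image (\<gamma> e) \<inter> path_image (\<gamma> f) \<subseteq> p ` (e \<inter> f)"
  using drawing by (simp add: plane_drawing_def)

lemma ends_in_edge: "e \<in> sedges S \<Longrightarrow> p ` e \<subseteq> path_image (\<gamma> e)"
  using edge_vertices by blast

lemma drawn_insert: "drawn (insert e F) = path_image (\<gamma> e) \<union> drawn F"
  by (auto simp: drawn_def)

lemma drawn_mono: "F \<subseteq> F' \<Longrightarrow> drawn F \<subseteq> drawn F'"
  by (auto simp: drawn_def)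

lemma compact_drawn: "F \<subseteq> sedges S \<Longrightarrow> compact (drawn F)"
  unfolding drawn_def using finite_edges edge_arc
  by (intro compact_UN) (auto simp: arc_imp_path compact_path_image)

lemma open_Compl_drawn: "F \<subseteq> sedges S \<Longrightarrow> open (- drawn F)"
  using compact_drawn compact_imp_closed by blast

lemma linked_mono: "F \<subseteq> F' \<Longrightarrow> linked F' a b \<Longrightarrow> linked F a b"
  using drawn_mono by (metis Compl_anti_mono connected_component_of_subset)

lemma edge_Int_drawn:
  assumes "e \<in> sedges S" "F \<subseteq> sedges S" "e \<notin> F"
  shows "path_image (\<gamma> e) \<inter> drawn F \<subseteq> p ` e"
  using assms edge_Int[of e] by (fastforce simp: drawn_def)

lemma oriented_edge:
  assumes "{x, y} \<in> sedges S"
  obtains a where "arc a" "pathstart a = p x" "pathfinish a = p y" "path_image a = path_image (\<gamma> {x, y})"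
proof (cases "pathstart (\<gamma> {x, y}) = p x")
  case True
  with edge_ends[OF assms] have "pathfinish (\<gamma> {x, y}) = p y"
    by (auto simp: doubleton_eq_iff)
  with that True edge_arc[OF assms] show thesis
    by blast
next
  case False
  with edge_ends[OF assms] have "pathstart (\<gamma> {x, y}) = p y" "pathfinish (\<gamma> {x, y}) = p x"
    by (auto simp: doubleton_eq_iff)
  with that[of "reversepath (\<gamma> {x, y})"] edge_arc[OF assms] show thesis
    by (auto simp: arc_reversepath)
qed

lemma path_arc:
  assumes "distinct xs" "length xs \<ge> 2" "path_edges xs \<subseteq> sedges S"
  shows "\<exists>a. arc a \<and> pathstart a = p (hd xs) \<and> pathfinish a = p (last xs) \<and> path_image a = drawn (path_edges xs)"
  using assms
proof (induction xs rule: path_edges.induct)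
  case (1 x y zs)
  then have E: "{x, y} \<in> sedges S" and dist: "x \<noteq> y" "x \<notin> set (y # zs)" "distinct (y # zs)"
    and sub: "path_edges (y # zs) \<subseteq> sedges S"
    by auto
  obtain b where b: "arc b" "pathstart b = p x" "pathfinish b = p y" "path_image b = path_image (\<gamma> {x, y})"
    using oriented_edge[OF E] by blast
  show ?case
  proof (cases "zs = []")
    case True
    with b show ?thesis
      by (intro exI[of _ b]) (auto simp: drawn_def)
  next
    case False
    then obtain a where a: "arc a" "pathstart a = p y" "pathfinish a = p (last (y # zs))"
      "path_image a = drawn (path_edges (y # zs))"
      using "1.IH" dist sub by (cases zs) auto
    have "path_image b \<inter> path_image a \<subseteq> {pathstart a}"
    proof
      fix z assume z: "z \<in> path_image b \<inter> path_image a"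
      then obtain f where f: "f \<in> path_edges (y # zs)" "z \<in> path_image (\<gamma> f)"
        by (auto simp: a drawn_def)
      have "x \<notin> f"
        using path_edges_subset[OF f(1)] dist(2) by blast
      then have "{x, y} \<noteq> f" and int: "{x, y} \<inter> f \<subseteq> {y}"
        by auto
      then have "z \<in> p ` ({x, y} \<inter> f)"
        using edge_Int[OF E, of f] sub f z b by blast
      with int show "z \<in> {pathstart a}"
        by (auto simp: a)
    qed
    then have "arc (b +++ a)"
      using a b by (intro arc_join) auto
    moreover have "path_image (b +++ a) = drawn (path_edges (x # y # zs))"
      using a b by (simp add: path_image_join drawn_insert)
    ultimately show ?thesis
      using a b by (intro exI[of _ "b +++ a"]) auto
  qed
qed auto

lemma connected_drawn_path:
  assumes "distinct xs" "length xs \<ge> 2" "path_edges xs \<subseteq> sedges S"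
  shows "connected (drawn (path_edges xs))"
  using path_arc[OF assms] arc_imp_path connected_path_image by metis

lemma ends_in_drawn_path:
  assumes "length xs \<ge> 2" "path_edges xs \<subseteq> sedges S"
  shows "p ` set xs \<subseteq> drawn (path_edges xs)"
  using ends_in_edge assms(2) unfolding Union_path_edges[OF assms(1), symmetric]
  by (fastforce simp: drawn_def)

lemma cycle_curve:
  assumes xs: "distinct xs" "length xs \<ge> 3" "path_edges xs \<subseteq> sedges S" and e: "{last xs, hd xs} \<in> sedges S"
  obtains c where "simple_path c" "pathfinish c = pathstart c"
    "path_image c = drawn (insert {last xs, hd xs} (path_edges xs))"
proof -
  obtain a where a: "arc a" "pathstart a = p (hd xs)" "pathfinish a = p (last xs)"
      "path_image a = drawn (path_edges xs)"
    using path_arc[OF xs(1) _ xs(3)] xs(2) by auto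
  obtain b where b: "arc b" "pathstart b = p (last xs)" "pathfinish b = p (hd xs)"
      "path_image b = path_image (\<gamma> {last xs, hd xs})"
    using oriented_edge[OF e] by blast
  have "path_image a \<inter> path_image b \<subseteq> {p (hd xs), p (last xs)}"
    using edge_Int_drawn[OF e xs(3) closing_edge_notin_path[OF xs(1,2)]] by (auto simp: a b)
  then have "simple_path (a +++ b)"
    using a b by (intro simple_path_join_loop) auto
  moreover have "path_image (a +++ b) = drawn (insert {last xs, hd xs} (path_edges xs))"
    using a b by (auto simp: path_image_join drawn_insert)
  ultimately show thesis
    using that[of "a +++ b"] a b by auto
qed

text \<open>Janiszewski's theorem for the cycle and the drawing of \<open>F\<close>: the closing
  edge meets \<open>F\<close> only in its ends, so the two sets intersect exactly in the path, which
  is connected.\<close>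

lemma cycle_separation:
  assumes xs: "distinct xs" "length xs \<ge> 3" "path_edges xs \<subseteq> F" and F: "F \<subseteq> sedges S"
    and e: "{last xs, hd xs} \<in> sedges S" "{last xs, hd xs} \<notin> F"
    and ab: "linked F a b" "linked (insert {last xs, hd xs} (path_edges xs)) a b"
  shows "linked (insert {last xs, hd xs} F) a b"
proof -
  let ?e = "{last xs, hd xs}"
  have len: "length xs \<ge> 2" and sub: "path_edges xs \<subseteq> sedges S"
    using xs F by auto
  have "p ` ?e \<subseteq> p ` set xs"
    using len by (cases "xs = []") (auto intro!: imageI)
  then have "p ` ?e \<subseteq> drawn (path_edges xs)"
    using ends_in_drawn_path[OF len sub] by blast
  then have Int: "drawn (insert ?e (path_edges xs)) \<inter> drawn F = drawn (path_edges xs)"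
    using edge_Int_drawn[OF e(1) F e(2)] drawn_mono[OF xs(3)] by (auto simp: drawn_insert)
  have "linked' a b" if "linked' = connected_component (- (drawn (insert ?e (path_edges xs)) \<union> drawn F))" for linked'
    unfolding that
    by (rule Janiszewski)
      (use Int ab F sub e(1) connected_drawn_path[OF xs(1) len sub] in
        \<open>auto intro!: compact_drawn compact_imp_closed\<close>)
  moreover have "drawn (insert ?e (path_edges xs)) \<union> drawn F = drawn (insert ?e F)"
    using drawn_mono[OF xs(3)] by (auto simp: drawn_insert)
  ultimately show ?thesis
    by simp
qed

lemma edge_not_separating:
  assumes "e \<in> sedges S" "a \<notin> path_image (\<gamma> e)" "b \<notin> path_image (\<gamma> e)"
  shows "connected_component (- path_image (\<gamma> e)) a b"
proof -
  have "connected (- path_image (\<gamma> e))"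
    using edge_arc[OF assms(1)] by (intro connected_arc_complement) simp_all
  then show ?thesis
    using assms by (simp add: connected_iff_connected_component)
qed

text \<open>The component \<open>F1\<close> of \<open>u\<close> and the rest \<open>F2\<close> are
  drawn disjointly, and the new edge meets them at most in \<open>p u\<close> and \<open>p v\<close>
  respectively. Janiszewski's theorem is applied twice, adding the edge to \<open>F1\<close> and
  then \<open>F2\<close> to both.\<close>

lemma bridge_separation:
  assumes F: "F \<subseteq> sedges S" and e: "{u, v} \<in> sedges S" "\<not> joined F u v"
    and ab: "linked F a b" "a \<notin> path_image (\<gamma> {u, v})" "b \<notin> path_image (\<gamma> {u, v})"
  shows "linked (insert {u, v} F) a b"
proof -
  define F1 where "F1 = {f \<in> F. \<exists>w\<in>f. joined F u w}"
  define F2 where "F2 = F - F1"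
  have sub: "F1 \<subseteq> sedges S" "F2 \<subseteq> sedges S" and F12: "F = F1 \<union> F2"
    using F by (auto simp: F1_def F2_def)
  have joined: "joined F u w'" if f: "f \<in> F1" "w' \<in> f" for f w'
  proof -
    obtain w where w: "f \<in> F" "w \<in> f" "joined F u w"
      using f by (auto simp: F1_def)
    then have "f = {w, w'}" if "w \<noteq> w'"
      using f that edge_card[of f] F by (auto simp: card_2_iff)
    then show ?thesis
      using w joined_step[of F u w w'] by (cases "w = w'") auto
  qed
  have v: "v \<notin> f" if "f \<in> F1" for f
    using joined[OF that] e(2) by blast
  have u: "u \<notin> f" if "f \<in> F2" for f
    using that joined_refl[of F u] by (auto simp: F2_def F1_def)
  have disj: "drawn F1 \<inter> drawn F2 = {}"
  proof -
    have "path_image (\<gamma> f1) \<inter> path_image (\<gamma> f2) = {}" if f: "f1 \<in> F1" "f2 \<in> F2" for f1 f2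
    proof -
      have "f1 \<inter> f2 = {}"
        using joined[OF f(1)] f(2) by (auto simp: F2_def F1_def)
      moreover have "f1 \<noteq> f2"
        using f by (auto simp: F2_def)
      ultimately show ?thesis
        using edge_Int[of f1 f2] f sub by auto
    qed
    then show ?thesis
      by (auto simp: drawn_def)
  qed
  let ?A = "path_image (\<gamma> {u, v})"
  have small: "connected X" if "X \<subseteq> {x}" for X :: "complex set" and x
    using that by (metis connected_empty connected_sing subset_singletonD)
  have 1: "connected_component (- (drawn F1 \<union> ?A)) a b"
  proof (rule Janiszewski)
    show "compact (drawn F1)" "closed ?A"
      using compact_drawn[OF sub(1)] edge_arc[OF e(1)] by (auto simp: closed_arc_image)
    have "?A \<inter> drawn F1 \<subseteq> {p u}"
    proof
      fix z assume z: "z \<in> ?A \<inter> drawn F1"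
      then obtain f where f: "f \<in> F1" "z \<in> path_image (\<gamma> f)"
        by (auto simp: drawn_def)
      with v[OF f(1)] have "z \<in> p ` ({u, v} \<inter> f)"
        using edge_Int[OF e(1), of f] sub z by blast
      with v[OF f(1)] show "z \<in> {p u}"
        by auto
    qed
    then show "connected (drawn F1 \<inter> ?A)"
      by (intro small[of _ "p u"]) auto
    show "linked F1 a b"
      using ab(1) by (rule linked_mono[rotated]) (auto simp: F12)
    show "connected_component (- ?A) a b"
      using e ab by (intro edge_not_separating)
  qed
  have "connected_component (- ((drawn F1 \<union> ?A) \<union> drawn F2)) a b"
  proof (rule Janiszewski[OF _ _ _ 1])
    show "compact (drawn F1 \<union> ?A)" "closed (drawn F2)"
      using compact_drawn[OF sub(1)] compact_drawn[OF sub(2)] edge_arc[OF e(1)]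
      by (auto simp: compact_imp_closed compact_arc_image)
    have "?A \<inter> drawn F2 \<subseteq> {p v}"
    proof
      fix z assume z: "z \<in> ?A \<inter> drawn F2"
      then obtain f where f: "f \<in> F2" "z \<in> path_image (\<gamma> f)"
        by (auto simp: drawn_def)
      with u[OF f(1)] have "z \<in> p ` ({u, v} \<inter> f)"
        using edge_Int[OF e(1), of f] sub z by blast
      with u[OF f(1)] show "z \<in> {p v}"
        by auto
    qed
    with disj show "connected ((drawn F1 \<union> ?A) \<inter> drawn F2)"
      by (intro small[of _ "p v"]) auto
    show "linked F2 a b"
      using ab(1) by (rule linked_mono[rotated]) (auto simp: F12)
  qed
  moreover have "(drawn F1 \<union> ?A) \<union> drawn F2 = drawn (insert {u, v} F)"
    by (auto simp: drawn_def F12)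
  ultimately show ?thesis
    by simp
qed

text \<open>A leaf edge meets the rest of the forest in at most one point, and an arc does not
  separate the plane, so Janiszewski's theorem restores the edge. The finite set \<open>A\<close>
  lets \<open>face_boundary_not_acyclic\<close> stay clear of the vertices.\<close>

lemma connected_acyclic_complement:
  assumes "F \<subseteq> sedges S" "acyclic_edges F" "finite A" "A \<subseteq> sverts S"
  shows "connected (- (drawn F \<union> p ` A))"
  using assms
proof (induction "card F" arbitrary: F A)
  case 0
  then have "F = {}"
    using finite_edges by auto
  moreover have "connected (- (p ` A))"
    using 0 by (intro path_connected_imp_connected path_connected_complement_countable)
      (auto intro: countable_finite)
  ultimately show ?case
    by (simp add: drawn_def)
next
  case (Suc k)
  note fin = finite_edges[OF Suc.prems(1)]
  have "F \<noteq> {}" "\<forall>e\<in>F. card e = 2"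
    using Suc.hyps(2) Suc.prems(1) edge_card by auto
  then obtain v w where vw: "{v, w} \<in> F" "v \<noteq> w" "\<And>f. f \<in> F \<Longrightarrow> v \<in> f \<Longrightarrow> f = {v, w}"
    using acyclic_edges_leaf[OF fin _ _ Suc.prems(2)] by metis
  define F' where "F' = F - {{v, w}}"
  have E: "{v, w} \<in> sedges S" and sub: "F' \<subseteq> sedges S"
    using vw(1) Suc.prems(1) by (auto simp: F'_def)
  have vF': "v \<notin> f" if "f \<in> F'" for f
    using that vw(3)[of f] by (auto simp: F'_def)
  \<comment> \<open>\<open>p v\<close> lies on the leaf edge anyway; removing \<open>v\<close> from
    \<open>A\<close> keeps the intersection of the two sets within the point
    \<open>p w\<close>.\<close>
  let ?X = "drawn F' \<union> p ` (A - {v})" and ?Y = "path_image (\<gamma> {v, w})"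
  have compl: "connected (- (?X \<union> ?Y))"
  proof (rule Janiszewski_connected)
    show "compact ?X"
      using compact_drawn[OF sub] Suc.prems(3) by (intro compact_Un) (auto intro: finite_imp_compact)
    show "closed ?Y"
      using edge_arc[OF E] by (rule closed_arc_image)
    show "connected (- ?Y)"
      using edge_arc[OF E] by (intro connected_arc_complement) simp_all
    show "connected (- ?X)"
    proof (rule Suc.hyps(1))
      show "k = card F'"
        using Suc.hyps(2) vw(1) fin by (simp add: F'_def)
      show "acyclic_edges F'"
        using Suc.prems(2) by (rule acyclic_edges_subset) (auto simp: F'_def)
    qed (use sub Suc.prems in auto)
    have "?X \<inter> ?Y \<subseteq> {p w}"
    proof
      fix z assume z: "z \<in> ?X \<inter> ?Y"
      show "z \<in> {p w}"
      proof (cases "z \<in> drawn F'")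
        case True
        then obtain f where f: "f \<in> F'" "z \<in> path_image (\<gamma> f)"
          by (auto simp: drawn_def)
        with vF'[OF f(1)] have "z \<in> p ` ({v, w} \<inter> f)"
          using edge_Int[OF E, of f] sub z by blast
        with vF'[OF f(1)] show ?thesis
          by auto
      next
        case False
        with z obtain x where x: "x \<in> A" "x \<noteq> v" "z = p x"
          by auto
        then have "z \<in> p ` {v, w}"
          using edge_vertices[OF E] z Suc.prems(4) by blast
        moreover have "p x \<noteq> p v"
          using x inj_p Suc.prems(4) edge_subset[OF E] by (metis inj_onD insert_subset subsetD)
        ultimately show ?thesis
          using x by auto
      qed
    qed
    then show "connected (?X \<inter> ?Y)"
      by (metis connected_empty connected_sing subset_singletonD)
  qed
  have "p v \<in> ?Y"
    using ends_in_edge[OF E] by auto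
  then have "?X \<union> ?Y = drawn F' \<union> ?Y \<union> p ` A"
    by blast
  moreover have "drawn F = ?Y \<union> drawn F'"
    unfolding drawn_insert[symmetric] using vw(1) by (simp add: F'_def insert_absorb)
  ultimately have "?X \<union> ?Y = drawn F \<union> p ` A"
    by (simp only: Un_commute)
  with compl show ?case
    by (simp only:)
qed

lemma cycle_regions:
  assumes xs: "distinct xs" "length xs \<ge> 3" "path_edges xs \<subseteq> sedges S" and e: "{last xs, hd xs} \<in> sedges S"
  obtains I J where "open I" "connected I" "open J" "connected J" "I \<inter> J = {}"
    "I \<union> J = - drawn (insert {last xs, hd xs} (path_edges xs))"
    "frontier I = drawn (insert {last xs, hd xs} (path_edges xs))"
    "frontier J = drawn (insert {last xs, hd xs} (path_edges xs))"
proof -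
  obtain c where c: "simple_path c" "pathfinish c = pathstart c"
    "path_image c = drawn (insert {last xs, hd xs} (path_edges xs))"
    using cycle_curve[OF xs e] by blast
  show thesis
    using Jordan_curve[OF c(1,2)] that unfolding c(3) by metis
qed

text \<open>
  Two points on the same side of a cycle through \<open>e\<close> stay connected when \<open>e\<close> is added: the cycle
  meets the rest of the drawing in a connected set, so Janiszewski's theorem applies.
\<close>
lemma edge_two_sides:
  assumes F: "F \<subseteq> sedges S" and e: "e \<in> sedges S" "e \<notin> F"
    and z: "z1 \<notin> drawn (insert e F)" "z2 \<notin> drawn (insert e F)" "z3 \<notin> drawn (insert e F)"
    and linked: "linked F z1 z2" "linked F z1 z3"
  shows "linked (insert e F) z1 z2 \<or> linked (insert e F) z1 z3 \<or> linked (insert e F) z2 z3"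
proof -
  obtain u v where uv: "e = {u, v}" "u \<noteq> v"
    using edge_card[OF e(1)] by (auto simp: card_2_iff)
  show ?thesis
  proof (cases "joined F u v")
    case False
    then have "linked (insert {u, v} F) z1 z2"
      using F e z linked unfolding uv by (intro bridge_separation) (auto simp: drawn_insert)
    then show ?thesis
      by (simp add: uv)
  next
    case True
    then obtain xs where xs: "length xs \<ge> 3" "distinct xs" "path_edges xs \<subseteq> F" "{last xs, hd xs} = {u, v}"
      using joined_cycle[OF True uv(2)] e(2) uv(1) by metis
    then have sub: "path_edges xs \<subseteq> sedges S" and E: "{last xs, hd xs} \<in> sedges S"
        "{last xs, hd xs} \<notin> F"
      using F e uv by auto
    obtain I J where IJ: "connected I" "connected J" "I \<union> J = - drawn (insert {last xs, hd xs} (path_edges xs))"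
      using cycle_regions[OF xs(2,1) sub E(1)] by metis
    have same: "linked (insert e F) a b"
      if "linked F a b" "a \<in> X" "b \<in> X" "connected X" "X \<subseteq> I \<union> J" for a b X
    proof -
      have "linked (insert {last xs, hd xs} (path_edges xs)) a b"
        using that IJ(3) by (auto intro: connected_componentI)
      then show ?thesis
        using cycle_separation[OF xs(2,1,3) F E] that(1) xs(4) uv(1) by simp
    qed
    have "drawn (insert {last xs, hd xs} (path_edges xs)) \<subseteq> drawn (insert e F)"
      using xs by (intro drawn_mono) (auto simp: uv)
    then have in_IJ: "z1 \<in> I \<union> J" "z2 \<in> I \<union> J" "z3 \<in> I \<union> J"
      using z IJ(3) by blast+
    \<comment> \<open>Of three points in \<open>I \<union> J\<close>, two lie on the same
      side.\<close>
    have "linked F z2 z3"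
      using linked connected_component_sym connected_component_trans by metis
    with linked in_IJ same[of z1 z2 I] same[of z1 z2 J] same[of z1 z3 I] same[of z1 z3 J]
      same[of z2 z3 I] same[of z2 z3 J] IJ(1,2) show ?thesis
      by blast
  qed
qed

text \<open>Represents the whole interior of \<open>e\<close>. That \<open>e\<close> lies on the
  boundary of the face of \<open>z\<close> is encoded below as
  \<open>linked (F - {e}) z (midpt e)\<close>: once \<open>e\<close> is erased, the face of
  \<open>z\<close> reaches it.\<close>

definition midpt :: "'v set \<Rightarrow> complex" where
  "midpt e = \<gamma> e (1/2)"

lemma edge_interior:
  assumes e: "e \<in> sedges S"
  shows "path_image (\<gamma> e) - p ` e = \<gamma> e ` {0<..<1}"
proof -
  have inj: "inj_on (\<gamma> e) {0..1}"
    using edge_arc[OF e] by (simp add: arc_def)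
  have "p ` e = \<gamma> e ` {0, 1}"
    using edge_ends[OF e] by (auto simp: pathstart_def pathfinish_def)
  then have "path_image (\<gamma> e) - p ` e = \<gamma> e ` ({0..1} - {0, 1})"
    unfolding path_image_def using inj by (subst inj_on_image_set_diff[of _ "{0..1}"]) auto
  also have "{0..1} - {0, 1} = {0<..<1::real}"
    by auto
  finally show ?thesis .
qed

lemma midpt_in: "e \<in> sedges S \<Longrightarrow> midpt e \<in> path_image (\<gamma> e) - p ` e"
  unfolding edge_interior midpt_def by (intro imageI) simp

lemma linked_midpt:
  assumes e: "e \<in> sedges S" "e \<notin> F" and F: "F \<subseteq> sedges S" and x: "x \<in> path_image (\<gamma> e) - p ` e"
  shows "linked F x (midpt e)"
proof (rule connected_componentI)
  show "connected (path_image (\<gamma> e) - p ` e)"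
    unfolding edge_interior[OF e(1)] using edge_arc[OF e(1)]
    by (intro connected_continuous_image) (auto simp: arc_def path_def intro: continuous_on_subset)
  show "path_image (\<gamma> e) - p ` e \<subseteq> - drawn F"
    using edge_Int_drawn[OF e(1) F e(2)] by blast
qed (use x midpt_in[OF e(1)] in auto)

text \<open>If the boundary edges \<open>B\<close> formed a forest, the plane without them and
  without the vertices would be connected, so a path-free connectedness argument from
  \<open>z\<close> to \<open>z'\<close> meets the frontier of the face of \<open>z\<close> at some
  \<open>x\<close> off \<open>B\<close>. But \<open>x\<close> is interior to an edge that borders
  this face.\<close>

lemma face_boundary_not_acyclic:
  assumes F: "F \<subseteq> sedges S" and z: "z \<notin> drawn F" "z' \<notin> drawn F" "\<not> linked F z z'"
  shows "\<not> acyclic_edges {e \<in> F. linked (F - {e}) z (midpt e)}"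
proof
  define B where "B = {e \<in> F. linked (F - {e}) z (midpt e)}"
  assume "acyclic_edges {e \<in> F. linked (F - {e}) z (midpt e)}"
  then have acyc: "acyclic_edges B"
    by (simp add: B_def)
  define f where "f = connected_component_set (- drawn F) z"
  \<comment> \<open>Leaving out the vertices guarantees that a frontier point in \<open>Q\<close>
    lies in the interior of exactly one edge.\<close>
  define Q where "Q = - (drawn B \<union> p ` \<Union> F)"
  have UF: "\<Union> F \<subseteq> sverts S" "finite (\<Union> F)"
    using F edge_subset simple finite_subset[of "\<Union> F" "sverts S"] by (auto simp: simple_graph_def)
  have conQ: "connected Q"
    unfolding Q_def using F UF acyc by (intro connected_acyclic_complement) (auto simp: B_def)
  have "p ` \<Union> F \<subseteq> drawn F"
    using ends_in_edge F by (fastforce simp: drawn_def)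
  moreover have "drawn B \<subseteq> drawn F"
    by (rule drawn_mono) (auto simp: B_def)
  ultimately have "- drawn F \<subseteq> Q"
    by (auto simp: Q_def)
  then have "z \<in> Q \<inter> f" "z' \<in> Q - f"
    using z by (auto simp: f_def)
  then obtain x where x: "x \<in> Q" "x \<in> frontier f"
    using connected_Int_frontier[OF conQ, of f] by blast
  have openf: "open f"
    unfolding f_def using open_Compl_drawn[OF F] by (rule open_connected_component)
  have "x \<in> drawn F"
  proof (rule ccontr)
    assume "x \<notin> drawn F"
    then obtain r where r: "r > 0" "ball x r \<subseteq> - drawn F"
      using open_Compl_drawn[OF F] by (meson ComplI open_contains_ball)
    have "x \<in> closure f"
      using x(2) by (simp add: frontier_def)
    then obtain y where y: "y \<in> f" "dist y x < r"
      using r(1) closure_approachable by blast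
    then have "linked F y x"
      using r by (intro connected_componentI[of "ball x r"]) (auto simp: dist_commute)
    then have "x \<in> f"
      using y(1) unfolding f_def by (auto intro: connected_component_trans)
    with x(2) openf show False
      by (simp add: frontier_def interior_open)
  qed
  then obtain e where e: "e \<in> F" "x \<in> path_image (\<gamma> e)"
    by (auto simp: drawn_def)
  have E: "e \<in> sedges S" and sub: "F - {e} \<subseteq> sedges S" "e \<notin> F - {e}"
    using e F by auto
  have xi: "x \<in> path_image (\<gamma> e) - p ` e"
    using x(1) e by (auto simp: Q_def)
  then have "x \<notin> drawn (F - {e})"
    using edge_Int_drawn[OF E sub] by blast
  then obtain r where r: "r > 0" "ball x r \<subseteq> - drawn (F - {e})"
    using open_Compl_drawn[OF sub(1)] by (meson ComplI open_contains_ball)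
  have "x \<in> closure f"
    using x(2) by (simp add: frontier_def)
  then obtain y where y: "y \<in> f" "dist y x < r"
    using r(1) closure_approachable by blast
  have "linked (F - {e}) y x"
    using y(2) r by (intro connected_componentI[of "ball x r"]) (auto simp: dist_commute)
  moreover have "linked (F - {e}) z y"
    using y(1) by (intro linked_mono[of "F - {e}" F]) (auto simp: f_def)
  ultimately have "linked (F - {e}) z (midpt e)"
    using linked_midpt[OF E sub(2,1) xi] by (meson connected_component_trans)
  then have "e \<in> B"
    using e by (simp add: B_def)
  with x(1) e(2) show False
    by (auto simp: Q_def drawn_def)
qed

text \<open>\<open>Z\<close> holds representatives of distinct faces. Near the midpoint of
  \<open>e\<close> there are points on both sides of the cycle; they share a face of
  \<open>F\<close> but are separated once \<open>e\<close> is drawn, so they can replace the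
  representative of that face.\<close>

lemma add_cycle_edge_face:
  assumes xs: "distinct xs" "length xs \<ge> 3" "path_edges xs \<subseteq> F" and F: "F \<subseteq> sedges S"
    and e: "{last xs, hd xs} = e" "e \<in> sedges S" "e \<notin> F"
    and Z: "finite Z" "Z \<inter> drawn F = {}" "\<forall>a\<in>Z. \<forall>b\<in>Z. a \<noteq> b \<longrightarrow> \<not> linked F a b"
  obtains Z' where "finite Z'" "Z' \<inter> drawn (insert e F) = {}" "card Z' \<ge> card Z + 1"
    "\<forall>a\<in>Z'. \<forall>b\<in>Z'. a \<noteq> b \<longrightarrow> \<not> linked (insert e F) a b"
proof -
  let ?C = "insert e (path_edges xs)"
  have sub: "path_edges xs \<subseteq> sedges S"
    using xs F by auto
  obtain I J where IJ: "open I" "open J" "I \<inter> J = {}" "I \<union> J = - drawn ?C"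
      "frontier I = drawn ?C" "frontier J = drawn ?C"
    using cycle_regions[OF xs(1,2) sub] e by metis
  have C: "drawn ?C \<subseteq> drawn (insert e F)" "path_image (\<gamma> e) \<subseteq> drawn ?C"
    using xs by (auto simp: drawn_insert drawn_def)
  \<comment> \<open>An old representative may lie on the new edge; it is moved off it within its
    face of \<open>F\<close>, into the side \<open>I\<close> of the cycle.\<close>
  have perturb: "\<exists>z'. linked F z z' \<and> z' \<notin> path_image (\<gamma> e)" if z: "z \<notin> drawn F" for z
  proof (cases "z \<in> path_image (\<gamma> e)")
    case True
    obtain r where r: "r > 0" "ball z r \<subseteq> - drawn F"
      using open_Compl_drawn[OF F] z by (meson ComplI open_contains_ball)
    have "z \<in> closure I"
      using True C(2) IJ(5) by (auto simp: frontier_def)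
    then obtain y where y: "y \<in> I" "dist y z < r"
      using r(1) closure_approachable by blast
    then have "linked F z y"
      using r by (intro connected_componentI[of "ball z r"]) (auto simp: dist_commute)
    moreover have "y \<notin> path_image (\<gamma> e)"
      using y(1) IJ(4) C(2) by blast
    ultimately show ?thesis
      by blast
  next
    case False
    with z show ?thesis
      by (auto intro: connected_component_refl)
  qed
  then obtain h where h: "\<And>z. z \<notin> drawn F \<Longrightarrow> linked F z (h z)" "\<And>z. z \<notin> drawn F \<Longrightarrow> h z \<notin> path_image (\<gamma> e)"
    by metis
  have m: "midpt e \<in> path_image (\<gamma> e)" "midpt e \<notin> drawn F"
    using midpt_in[OF e(2)] edge_Int_drawn[OF e(2) F e(3)] by auto
  then obtain r where r: "r > 0" "ball (midpt e) r \<subseteq> - drawn F"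
    using open_Compl_drawn[OF F] by (meson ComplI open_contains_ball)
  have "midpt e \<in> closure I" "midpt e \<in> closure J"
    using m C(2) IJ(5,6) by (auto simp: frontier_def)
  then obtain a b where ab: "a \<in> I" "dist a (midpt e) < r" "b \<in> J" "dist b (midpt e) < r"
    using r(1) closure_approachable by metis
  have linked_ab: "linked F (midpt e) a" "linked F (midpt e) b"
    using ab r by (auto intro!: connected_componentI[of "ball (midpt e) r"] simp: dist_commute)
  have notin_ab: "a \<notin> drawn (insert e F)" "b \<notin> drawn (insert e F)"
    using linked_ab ab IJ(4) C(2) by (auto simp: drawn_insert dest: connected_component_in)
  have sep_ab: "\<not> linked (insert e F) a b"
  proof
    assume "linked (insert e F) a b"
    then have "connected_component (- drawn ?C) a b"
      using C(1) by (meson Compl_anti_mono connected_component_of_subset)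
    then obtain T where T: "connected T" "T \<subseteq> I \<union> J" "a \<in> T" "b \<in> T"
      using IJ(4) by (auto simp: connected_component_def)
    then show False
      using connectedD[OF T(1) IJ(1,2)] IJ(3) ab by blast
  qed
  have linked_sub: "linked F x y" if "linked (insert e F) x y" for x y
    using that by (rule linked_mono[rotated]) auto
  have sym: "linked F y x" if "linked F x y" for x y
    using that by (rule connected_component_sym)
  note trans = connected_component_trans[of "- drawn F"]
  \<comment> \<open>At most one representative lies in the face that \<open>e\<close> cuts; it is
    dropped in favour of \<open>a\<close> and \<open>b\<close>.\<close>
  define Z1 where "Z1 = {z \<in> Z. \<not> linked F z (midpt e)}"
  have Z1: "Z1 \<subseteq> Z" "finite Z1"
    using Z(1) by (auto simp: Z1_def)
  have "card (Z - Z1) \<le> 1"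
  proof -
    have "x = y" if "x \<in> Z - Z1" "y \<in> Z - Z1" for x y
    proof -
      have "linked F x (midpt e)" "linked F (midpt e) y"
        using that sym by (auto simp: Z1_def)
      then have "linked F x y"
        by (rule trans)
      with that Z(3) show ?thesis
        by blast
    qed
    then show ?thesis
      using Z(1) by (simp add: card_le_Suc0_iff_eq)
  qed
  then have cardZ1: "card Z \<le> card Z1 + 1"
    using Z1 Z(1) by (simp add: card_Diff_subset)
  have hlink: "linked F z (h z)" "h z \<notin> drawn (insert e F)" if "z \<in> Z1" for z
  proof -
    have "z \<notin> drawn F"
      using that Z1(1) Z(2) by blast
    then show "linked F z (h z)" "h z \<notin> drawn (insert e F)"
      using h connected_component_in by (fastforce simp: drawn_insert)+
  qed
  have hsep: "\<not> linked F (h x) (h y)" if "x \<in> Z1" "y \<in> Z1" "x \<noteq> y" for x y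
    using that hlink Z1(1) Z(3) sym trans by (metis subsetD)
  have habsep: "\<not> linked F (h x) a" "\<not> linked F (h x) b" if "x \<in> Z1" for x
    using that hlink(1)[OF that] linked_ab sym trans unfolding Z1_def by (metis mem_Collect_eq)+
  have refl: "linked F x x" if "x \<notin> drawn (insert e F)" for x
    using that by (simp add: connected_component_refl_eq drawn_insert)
  have inj: "inj_on h Z1"
    using hsep hlink refl by (metis inj_onI)
  have "a \<notin> h ` Z1" "b \<notin> h ` Z1" "a \<noteq> b"
    using habsep refl[OF notin_ab(1)] refl[OF notin_ab(2)] ab(1,3) IJ(3) by blast+
  then have "card (insert a (insert b (h ` Z1))) = card Z1 + 2"
    using Z1 inj by (simp add: card_image)
  then have "card (insert a (insert b (h ` Z1))) \<ge> card Z + 1"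
    using cardZ1 by simp
  moreover have "\<forall>x\<in>insert a (insert b (h ` Z1)). \<forall>y\<in>insert a (insert b (h ` Z1)).
      x \<noteq> y \<longrightarrow> \<not> linked (insert e F) x y"
    using hsep habsep sep_ab linked_sub sym connected_component_sym[of "- drawn (insert e F)"]
    by (metis (no_types, lifting) imageE insertE)
  ultimately show thesis
    using that[of "insert a (insert b (h ` Z1))"] Z1 notin_ab hlink by auto
qed

lemma ex_separated_points:
  assumes T: "T \<subseteq> sedges S" and X: "X \<subseteq> sedges S" "finite X" "X \<inter> T = {}"
    and cyc: "\<forall>e\<in>X. \<exists>xs. distinct xs \<and> length xs \<ge> 3 \<and> path_edges xs \<subseteq> T \<and> {last xs, hd xs} = e"
  shows "\<exists>Z. finite Z \<and> Z \<inter> drawn (T \<union> X) = {} \<and> card Z \<ge> card X + 1 \<and>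
     (\<forall>a\<in>Z. \<forall>b\<in>Z. a \<noteq> b \<longrightarrow> \<not> linked (T \<union> X) a b)"
  using X(2,1,3) cyc
proof (induction X rule: finite_induct)
  case empty
  have "drawn T \<noteq> UNIV"
    using compact_drawn[OF T] by (metis compact_imp_bounded not_bounded_UNIV)
  then obtain z where "z \<notin> drawn T"
    by blast
  then show ?case
    by (intro exI[of _ "{z}"]) auto
next
  case (insert e X)
  then obtain Z where Z: "finite Z" "Z \<inter> drawn (T \<union> X) = {}" "card Z \<ge> card X + 1"
     "\<forall>a\<in>Z. \<forall>b\<in>Z. a \<noteq> b \<longrightarrow> \<not> linked (T \<union> X) a b"
    by auto
  obtain xs where xs: "distinct xs" "length xs \<ge> 3" "path_edges xs \<subseteq> T" "{last xs, hd xs} = e"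
    using bspec[OF insert.prems(3) insertI1] by blast
  obtain Z' where "finite Z'" "Z' \<inter> drawn (insert e (T \<union> X)) = {}" "card Z' \<ge> card Z + 1"
    "\<forall>a\<in>Z'. \<forall>b\<in>Z'. a \<noteq> b \<longrightarrow> \<not> linked (insert e (T \<union> X)) a b"
  proof (rule add_cycle_edge_face[OF xs(1,2) _ _ xs(4) _ _ Z(1,2,4)])
    show "path_edges xs \<subseteq> T \<union> X" "T \<union> X \<subseteq> sedges S" "e \<in> sedges S" "e \<notin> T \<union> X"
      using xs T insert by auto
  qed
  then show ?case
    using Z(3) insert.hyps by (intro exI[of _ Z']) auto
qed

section \<open>Spanning forests and the face count\<close>

lemma maximal_acyclic:
  assumes "finite F"
  obtains T where "T \<subseteq> F" "acyclic_edges T"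
    "\<And>e. e \<in> F - T \<Longrightarrow> \<exists>xs. distinct xs \<and> length xs \<ge> 3 \<and> path_edges xs \<subseteq> T \<and> {last xs, hd xs} = e"
proof -
  define \<T> where "\<T> = {T. T \<subseteq> F \<and> acyclic_edges T}"
  have "acyclic_edges {}"
    by (auto simp: acyclic_edges_def cycle_in_def)
  then have "{} \<in> \<T>" "finite \<T>"
    using assms by (auto simp: \<T>_def)
  then obtain T where T: "T \<in> \<T>" "\<And>T'. T' \<in> \<T> \<Longrightarrow> T \<subseteq> T' \<Longrightarrow> T = T'"
    using finite_has_maximal[of \<T>] by blast
  have "\<exists>xs. distinct xs \<and> length xs \<ge> 3 \<and> path_edges xs \<subseteq> T \<and> {last xs, hd xs} = e" if e: "e \<in> F - T" for e
  proof -
    have "insert e T \<notin> \<T>"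
      using T(2)[of "insert e T"] e by auto
    then obtain xs where xs: "cycle_in (insert e T) xs"
      using e T(1) by (auto simp: \<T>_def acyclic_edges_def)
    have "\<not> cycle_in T xs"
      using T(1) by (simp add: \<T>_def acyclic_edges_def)
    then have "e \<in> insert {last xs, hd xs} (path_edges xs)"
      using xs by (auto simp: cycle_in_def)
    then obtain ys where ys: "cycle_in (insert e T) ys" "{last ys, hd ys} = e"
      using cycle_in_rotate[OF xs] by blast
    then have "e \<notin> path_edges ys"
      using closing_edge_notin_path[of ys] by (auto simp: cycle_in_def)
    with ys show ?thesis
      by (intro exI[of _ ys]) (auto simp: cycle_in_def)
  qed
  then show thesis
    using that[of T] T(1) by (auto simp: \<T>_def)
qed

text \<open>Double counting of faces and boundary edges: each boundary contains a cycle and so at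
  least \<open>g\<close> edges, while an edge borders at most two faces. Every edge outside the
  spanning forest \<open>T\<close> contributes a face, which gives
  \<open>card F + 1 <= card Z + card (\<Union> F)\<close>.\<close>

lemma girth_edge_bound:
  assumes F: "F \<subseteq> sedges S" "F \<noteq> {}" and girth: "\<And>xs. cycle_in F xs \<Longrightarrow> g \<le> length xs"
  shows "g * (card F + 1) \<le> 2 * card F + g * card (\<Union> F)"
proof -
  have fin: "finite F"
    using finite_edges[OF F(1)] .
  have card2: "\<forall>e\<in>F. card e = 2"
    using F edge_card by blast
  obtain T where T: "T \<subseteq> F" "acyclic_edges T"
    and cyc: "\<And>e. e \<in> F - T \<Longrightarrow> \<exists>xs. distinct xs \<and> length xs \<ge> 3 \<and> path_edges xs \<subseteq> T \<and> {last xs, hd xs} = e"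
    using maximal_acyclic[OF fin] by blast
  have UF: "finite (\<Union> F)"
    using fin card2 by (intro finite_Union) (auto intro: card_ge_0_finite)
  have "\<Union> F \<noteq> {}"
    using F(2) card2 by fastforce
  then have cardT: "card T + 1 \<le> card (\<Union> F)"
    using T UF fin card2 by (intro card_acyclic_edges) (auto dest: finite_subset)
  show ?thesis
  \<comment> \<open>A forest has a single face, whose boundary contains no cycle, so it is treated
    apart.\<close>
  proof (cases "F = T")
    case True
    then have "g * (card F + 1) \<le> g * card (\<Union> F)"
      using cardT by (intro mult_le_mono2) simp
    then show ?thesis
      by simp
  next
    case False
    have TF: "T \<union> (F - T) = F"
      using T by auto
    have "\<exists>Z. finite Z \<and> Z \<inter> drawn (T \<union> (F - T)) = {} \<and> card Z \<ge> card (F - T) + 1 \<and>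
     (\<forall>a\<in>Z. \<forall>b\<in>Z. a \<noteq> b \<longrightarrow> \<not> linked (T \<union> (F - T)) a b)"
      by (rule ex_separated_points) (use T F fin cyc in auto)
    then obtain Z where Z: "finite Z" "Z \<inter> drawn F = {}" "card Z \<ge> card (F - T) + 1"
      "\<forall>a\<in>Z. \<forall>b\<in>Z. a \<noteq> b \<longrightarrow> \<not> linked F a b"
      unfolding TF by blast
    have "card (F - T) > 0"
      using False T fin by (simp add: card_gt_0_iff)
    then have Z2: "card Z \<ge> 2"
      using Z(3) by simp
    define B where "B z = {e \<in> F. linked (F - {e}) z (midpt e)}" for z
    have finB: "finite (B z)" for z
      using fin by (simp add: B_def)
    have Bg: "g \<le> card (B z)" if z: "z \<in> Z" for z
    proof -
      obtain z' where "z' \<in> Z" "z' \<noteq> z"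
        using Z2 Z(1) z by (metis card_le_Suc0_iff_eq not_less_eq_eq numeral_2_eq_2)
      then have "\<not> acyclic_edges (B z)"
        unfolding B_def using Z z F(1) by (intro face_boundary_not_acyclic[of _ _ z']) auto
      then obtain xs where xs: "cycle_in (B z) xs"
        by (auto simp: acyclic_edges_def)
      then have "g \<le> length xs"
        by (intro girth cycle_in_mono[OF xs]) (auto simp: B_def)
      also have "\<dots> \<le> card (B z)"
        using xs finB by (rule cycle_in_length_le)
      finally show ?thesis .
    qed
    have two: "card {z \<in> Z. e \<in> B z} \<le> 2" if e: "e \<in> F" for e
    proof (rule ccontr)
      assume "\<not> ?thesis"
      then have "3 \<le> card {z \<in> Z. e \<in> B z}"
        by simp
      then obtain W where W: "W \<subseteq> {z \<in> Z. e \<in> B z}" "card W = 3"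
        by (meson obtain_subset_with_card_n)
      then obtain z1 z2 z3 where zs: "z1 \<in> Z" "z2 \<in> Z" "z3 \<in> Z" "z1 \<noteq> z2" "z1 \<noteq> z3" "z2 \<noteq> z3"
        "e \<in> B z1" "e \<in> B z2" "e \<in> B z3"
        unfolding card_3_iff by blast
      have eF: "insert e (F - {e}) = F"
        using e by auto
      have mid: "linked (F - {e}) z (midpt e)" if "e \<in> B z" for z
        using that by (simp add: B_def)
      have "linked (F - {e}) z1 z2" "linked (F - {e}) z1 z3"
        using mid[OF zs(7)] mid[OF zs(8)] mid[OF zs(9)]
        by (auto intro: connected_component_trans[OF _ connected_component_sym])
      then have "linked F z1 z2 \<or> linked F z1 z3 \<or> linked F z2 z3"
        using edge_two_sides[of "F - {e}" e z1 z2 z3] F e zs Z(2) unfolding eF by blast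
      then show False
        using zs Z(4) by blast
    qed
    have "g * card Z \<le> (\<Sum>z\<in>Z. card (B z))"
      using sum_bounded_below[of Z g "\<lambda>z. card (B z)"] Bg by (simp add: mult.commute)
    also have "\<dots> = (\<Sum>z\<in>Z. \<Sum>e\<in>F. if e \<in> B z then 1 else 0)"
    proof (rule sum.cong)
      fix z
      have "B z = {e \<in> F. e \<in> B z}"
        by (auto simp: B_def)
      then have "card (B z) = (\<Sum>e\<in>{e \<in> F. e \<in> B z}. 1)"
        by simp
      also have "\<dots> = (\<Sum>e\<in>F. if e \<in> B z then 1 else 0)"
        using fin by (rule sum.inter_filter)
      finally show "card (B z) = (\<Sum>e\<in>F. if e \<in> B z then 1 else 0)" .
    qed simp
    also have "\<dots> = (\<Sum>e\<in>F. \<Sum>z\<in>Z. if e \<in> B z then 1 else 0)"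
      by (rule sum.swap)
    also have "\<dots> = (\<Sum>e\<in>F. card {z \<in> Z. e \<in> B z})"
      using Z(1) by (intro sum.cong) (simp_all add: sum.inter_filter[symmetric])
    also have "\<dots> \<le> 2 * card F"
      using sum_bounded_above[of F "\<lambda>e. card {z \<in> Z. e \<in> B z}" 2] two by (simp add: mult.commute)
    finally have gZ: "g * card Z \<le> 2 * card F" .
    have "card F = card (F - T) + card T"
      using T(1) fin by (metis add.commute card_Diff_subset card_mono finite_subset le_add_diff_inverse)
    then have "card F + 1 \<le> card Z + card (\<Union> F)"
      using Z(3) cardT by simp
    then have "g * (card F + 1) \<le> g * (card Z + card (\<Union> F))"
      by (rule mult_le_mono2)
    with gZ show ?thesis
      by (simp add: algebra_simps)
  qed
qed

end

section \<open>Kinds of adjacency\<close>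

text \<open>
  Seen from \<open>u\<close>, an arc or edge to \<open>v\<close> has one of \<open>2n + m\<close> kinds: for \<open>k < n\<close> an outgoing
  arc of type \<open>2k + 2\<close>, for \<open>n \<le> k < 2n\<close> an incoming arc of type \<open>2(k - n) + 2\<close>, and
  otherwise an edge of type \<open>k + 1\<close>.
\<close>
definition adj :: "nat \<Rightarrow> 'v mixed_graph \<Rightarrow> nat \<Rightarrow> 'v \<Rightarrow> 'v \<Rightarrow> bool" where
  "adj n H k u v \<longleftrightarrow>
     (if k < n then (u, v, 2 * k + 2) \<in> arcs H
      else if k < 2 * n then (v, u, 2 * (k - n) + 2) \<in> arcs H
      else ({u, v}, k + 1) \<in> edges H)"

text \<open>Turns the viewpoint of \<open>adj\<close> into a construction: \<open>(u, v, k)\<close>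
  in \<open>D\<close> requests an adjacency of kind \<open>k\<close> seen from \<open>u\<close>, so
  kinds can be prescribed along a walk whichever way the arcs point.\<close>

definition kind_graph :: "nat \<Rightarrow> 'v set \<Rightarrow> ('v \<times> 'v \<times> nat) set \<Rightarrow> 'v mixed_graph" where
  "kind_graph n V D =
     \<lparr>verts = V,
      arcs = {(u, v, 2 * k + 2) |u v k. (u, v, k) \<in> D \<and> k < n} \<union>
        {(v, u, 2 * (k - n) + 2) |u v k. (u, v, k) \<in> D \<and> n \<le> k \<and> k < 2 * n},
      edges = {({u, v}, k + 1) |u v k. (u, v, k) \<in> D \<and> 2 * n \<le> k}\<rparr>"

lemma adj_sym_edge: "\<not> k < 2 * n \<Longrightarrow> adj n H k u v \<longleftrightarrow> adj n H k v u"
  by (simp add: adj_def insert_commute)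

lemma adj_kind_graph: "(u, v, k) \<in> D \<Longrightarrow> adj n (kind_graph n V D) k u v"
  by (auto simp: adj_def kind_graph_def)

lemma verts_kind_graph [simp]: "verts (kind_graph n V D) = V"
  by (simp add: kind_graph_def)

lemma und_kind_graph:
  "und (kind_graph n V D) = \<lparr>sverts = V, sedges = (\<lambda>(u, v, k). {u, v}) ` D\<rparr>"
proof -
  have "{{u, v} |u v \<alpha>. (u, v, \<alpha>) \<in> arcs (kind_graph n V D)} = {{u, v} |u v k. (u, v, k) \<in> D \<and> k < 2 * n}" (is "?A = ?B")
  proof
    show "?A \<subseteq> ?B"
      by (fastforce simp: kind_graph_def insert_commute)
    have "(u, v, 2 * k + 2) \<in> arcs (kind_graph n V D) \<or> (v, u, 2 * (k - n) + 2) \<in> arcs (kind_graph n V D)"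
      if "(u, v, k) \<in> D" "k < 2 * n" for u v k
      using that by (cases "k < n") (auto simp: kind_graph_def)
    then show "?B \<subseteq> ?A"
      by (smt (verit) insert_commute mem_Collect_eq subsetI)
  qed
  moreover have "fst ` edges (kind_graph n V D) = {{u, v} |u v k. (u, v, k) \<in> D \<and> \<not> k < 2 * n}"
    by (force simp: kind_graph_def)
  moreover have "{{u, v} |u v k. (u, v, k) \<in> D \<and> k < 2 * n} \<union> {{u, v} |u v k. (u, v, k) \<in> D \<and> \<not> k < 2 * n}
      = (\<lambda>(u, v, k). {u, v}) ` D"
    by force
  ultimately show ?thesis
    by (simp add: und_def)
qed

lemma nm_graph_iff:
  "nm_graph n m G \<longleftrightarrow> finite (verts G) \<and>
     (\<forall>u v \<alpha>. (u, v, \<alpha>) \<in> arcs G \<longrightarrow>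
       u \<in> verts G \<and> v \<in> verts G \<and> u \<noteq> v \<and> even \<alpha> \<and> 2 \<le> \<alpha> \<and> \<alpha> \<le> 2 * n) \<and>
     (\<forall>e \<alpha>. (e, \<alpha>) \<in> edges G \<longrightarrow> e \<subseteq> verts G \<and> card e = 2 \<and> 2 * n + 1 \<le> \<alpha> \<and> \<alpha> \<le> 2 * n + m) \<and>
     (\<forall>u v \<alpha>. (u, v, \<alpha>) \<in> arcs G \<longrightarrow> (\<forall>u' v' \<beta>. (u', v', \<beta>) \<in> arcs G \<longrightarrow>
       {u, v} = {u', v'} \<longrightarrow> (u, v, \<alpha>) = (u', v', \<beta>))) \<and>
     (\<forall>e \<alpha>. (e, \<alpha>) \<in> edges G \<longrightarrow> (\<forall>e' \<beta>. (e', \<beta>) \<in> edges G \<longrightarrow> e = e' \<longrightarrow> \<alpha> = \<beta>)) \<and>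
     (\<forall>u v \<alpha>. (u, v, \<alpha>) \<in> arcs G \<longrightarrow> (\<forall>e \<beta>. (e, \<beta>) \<in> edges G \<longrightarrow> {u, v} \<noteq> e))"
  unfolding nm_graph_def Ball_def split_paired_All prod.case by (rule refl)

lemma nm_graph_kind_graph:
  assumes "finite V"
    and D: "\<And>u v k. (u, v, k) \<in> D \<Longrightarrow> u \<in> V \<and> v \<in> V \<and> u \<noteq> v \<and> k < 2 * n + m"
    and coherent: "\<And>u v k u' v' k'. (u, v, k) \<in> D \<Longrightarrow> (u', v', k') \<in> D \<Longrightarrow> {u, v} = {u', v'} \<Longrightarrow> u = u' \<and> v = v' \<and> k = k'"
  shows "nm_graph n m (kind_graph n V D)"
proof -
  let ?G = "kind_graph n V D"
  have arcE: "\<exists>k. ((u, v, k) \<in> D \<and> k < n \<and> \<alpha> = 2 * k + 2) \<or> ((v, u, k) \<in> D \<and> n \<le> k \<and> k < 2 * n \<and> \<alpha> = 2 * (k - n) + 2)"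
    if "(u, v, \<alpha>) \<in> arcs ?G" for u v \<alpha>
    using that by (auto simp: kind_graph_def)
  have edgeE: "\<exists>u v k. (u, v, k) \<in> D \<and> 2 * n \<le> k \<and> e = {u, v} \<and> \<alpha> = k + 1"
    if "(e, \<alpha>) \<in> edges ?G" for e \<alpha>
    using that by (auto simp: kind_graph_def)
  show ?thesis
    unfolding nm_graph_iff
  proof (intro conjI allI impI)
    show "finite (verts ?G)"
      using assms(1) by simp
  next
    fix u v \<alpha> assume "(u, v, \<alpha>) \<in> arcs ?G"
    then obtain k where "((u, v, k) \<in> D \<and> k < n \<and> \<alpha> = 2 * k + 2) \<or>
        ((v, u, k) \<in> D \<and> n \<le> k \<and> k < 2 * n \<and> \<alpha> = 2 * (k - n) + 2)"
      using arcE by blast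
    then show "u \<in> verts ?G" "v \<in> verts ?G" "u \<noteq> v" "even \<alpha>" "2 \<le> \<alpha>" "\<alpha> \<le> 2 * n"
      using D[of u v k] D[of v u k] by auto
  next
    fix e \<alpha> assume "(e, \<alpha>) \<in> edges ?G"
    then obtain u v k where "(u, v, k) \<in> D" "2 * n \<le> k" "e = {u, v}" "\<alpha> = k + 1"
      using edgeE by blast
    then show "e \<subseteq> verts ?G" "card e = 2" "2 * n + 1 \<le> \<alpha>" "\<alpha> \<le> 2 * n + m"
      using D[of u v k] by auto
  next
    fix u v \<alpha> u' v' \<beta>
    assume arcs: "(u, v, \<alpha>) \<in> arcs ?G" "(u', v', \<beta>) \<in> arcs ?G" and eq: "{u, v} = {u', v'}"
    obtain k where k: "((u, v, k) \<in> D \<and> k < n \<and> \<alpha> = 2 * k + 2) \<or> ((v, u, k) \<in> D \<and> n \<le> k \<and> k < 2 * n \<and> \<alpha> = 2 * (k - n) + 2)"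
      using arcE[OF arcs(1)] by blast
    obtain l where l: "((u', v', l) \<in> D \<and> l < n \<and> \<beta> = 2 * l + 2) \<or> ((v', u', l) \<in> D \<and> n \<le> l \<and> l < 2 * n \<and> \<beta> = 2 * (l - n) + 2)"
      using arcE[OF arcs(2)] by blast
    have eq': "{v, u} = {u', v'}" "{u, v} = {v', u'}" "{v, u} = {v', u'}"
      using eq by (simp_all add: insert_commute)
    show "(u, v, \<alpha>) = (u', v', \<beta>)"
      using k l
    proof (elim disjE conjE, goal_cases)
      case 1
      then show ?case using coherent[OF _ _ eq, of k l] by simp
    next
      case 2
      then show ?case using coherent[OF _ _ eq'(2), of k l] by simp
    next
      case 3
      then show ?case using coherent[OF _ _ eq'(1), of k l] by simp
    next
      case 4
      then show ?case using coherent[OF _ _ eq'(3), of k l] by simp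
    qed
  next
    fix e \<alpha> e' \<beta> assume "(e, \<alpha>) \<in> edges ?G" "(e', \<beta>) \<in> edges ?G" "e = e'"
    then show "\<alpha> = \<beta>"
      using edgeE coherent by metis
  next
    fix u v \<alpha> e \<beta> assume arc: "(u, v, \<alpha>) \<in> arcs ?G" and edge: "(e, \<beta>) \<in> edges ?G"
    obtain k where k: "(u, v, k) \<in> D \<and> k < n \<or> (v, u, k) \<in> D \<and> k < 2 * n"
      using arcE[OF arc] by blast
    obtain a b l where l: "(a, b, l) \<in> D" "2 * n \<le> l" "e = {a, b}"
      using edgeE[OF edge] by blast
    show "{u, v} \<noteq> e"
    proof
      assume "{u, v} = e"
      then have eq: "{u, v} = {a, b}" "{v, u} = {a, b}"
        by (simp_all add: l(3) insert_commute)
      from k have "k = l \<and> k < 2 * n"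
      proof (elim disjE conjE)
        assume "(u, v, k) \<in> D" "k < n"
        then show ?thesis
          using coherent[OF _ l(1) eq(1)] by simp
      next
        assume "(v, u, k) \<in> D" "k < 2 * n"
        then show ?thesis
          using coherent[OF _ l(1) eq(2)] by simp
      qed
      with l(2) show False
        by simp
    qed
  qed
qed

lemma nm_graph_arc:
  assumes "nm_graph n m H" "(a, b, \<alpha>) \<in> arcs H"
  shows "a \<in> verts H \<and> b \<in> verts H \<and> a \<noteq> b \<and> even \<alpha> \<and> 2 \<le> \<alpha> \<and> \<alpha> \<le> 2 * n"
  using assms unfolding nm_graph_iff by metis

lemma nm_graph_edge:
  assumes "nm_graph n m H" "(e, \<alpha>) \<in> edges H"
  shows "e \<subseteq> verts H \<and> card e = 2 \<and> 2 * n + 1 \<le> \<alpha> \<and> \<alpha> \<le> 2 * n + m"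
  using assms unfolding nm_graph_iff by metis

lemma nm_graph_arcs_unique:
  assumes "nm_graph n m H" "(a, b, \<alpha>) \<in> arcs H" "(a', b', \<beta>) \<in> arcs H" "{a, b} = {a', b'}"
  shows "(a, b, \<alpha>) = (a', b', \<beta>)"
  using assms unfolding nm_graph_iff by metis

lemma nm_graph_edges_unique:
  assumes "nm_graph n m H" "(e, \<alpha>) \<in> edges H" "(e, \<beta>) \<in> edges H"
  shows "\<alpha> = \<beta>"
  using assms unfolding nm_graph_iff by metis

lemma nm_graph_arc_edge:
  assumes "nm_graph n m H" "(a, b, \<alpha>) \<in> arcs H" "(e, \<beta>) \<in> edges H"
  shows "{a, b} \<noteq> e"
  using assms unfolding nm_graph_iff by metis

lemma hom_adj:
  assumes "is_hom G H f" "adj n G k u v"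
  shows "adj n H k (f u) (f v)"
  using assms unfolding is_hom_def adj_def by (fastforce split: if_splits)

lemma adj_verts:
  assumes H: "nm_graph n m H" and uv: "adj n H k u v"
  shows "u \<in> verts H" "v \<in> verts H" "u \<noteq> v"
proof -
  note 1 = nm_graph_arc[OF H] and 2 = nm_graph_edge[OF H]
  show "u \<in> verts H" "v \<in> verts H" "u \<noteq> v"
    using uv 1[of u v] 1[of v u] 2[of "{u, v}"] unfolding adj_def by (auto split: if_splits)
qed

text \<open>Makes the neighbourhoods of a vertex for different kinds disjoint, so that their sizes
  add up. Outgoing and incoming arcs of one type are told apart by
  \<open>u \<noteq> v\<close>.\<close>

lemma adj_kind_unique:
  assumes H: "nm_graph n m H" and "adj n H k u v" "adj n H l u v"
  shows "k = l"
proof -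
  note 1 = nm_graph_arcs_unique[OF H] and 2 = nm_graph_edges_unique[OF H] and 3 = nm_graph_arc_edge[OF H]
  have "u \<noteq> v"
    using adj_verts[OF assms(1,2)] by blast
  define T where "T k = (if k < n then (u, v, 2 * k + 2) else (v, u, 2 * (k - n) + 2))" for k
  have T: "T k \<in> arcs H" if "adj n H k u v" "k < 2 * n" for k
    using that by (simp add: T_def adj_def split: if_splits)
  have ends: "{fst (T k), fst (snd (T k))} = {u, v}" for k
    by (simp add: T_def insert_commute)
  have T_eq: "T k = T l" if "T k \<in> arcs H" "T l \<in> arcs H" for k l
    using 1[of "fst (T k)" "fst (snd (T k))" "snd (snd (T k))" "fst (T l)" "fst (snd (T l))" "snd (snd (T l))"]
      that ends[of k] ends[of l] by simp
  show ?thesis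
  proof (cases "k < 2 * n"; cases "l < 2 * n")
    assume "k < 2 * n" "l < 2 * n"
    then have "T k = T l"
      using T T_eq assms(2,3) by blast
    then show ?thesis
      using \<open>u \<noteq> v\<close> by (auto simp: T_def split: if_splits)
  next
    assume k: "k < 2 * n" and l: "\<not> l < 2 * n"
    have False
      using T[OF assms(2) k] assms(3) l 3[of u v "2 * k + 2" "{u, v}" "l + 1"] 3[of v u "2 * (k - n) + 2" "{u, v}" "l + 1"]
      by (simp add: T_def adj_def insert_commute split: if_splits)
    then show ?thesis ..
  next
    assume k: "\<not> k < 2 * n" and l: "l < 2 * n"
    have False
      using T[OF assms(3) l] assms(2) k 3[of u v "2 * l + 2" "{u, v}" "k + 1"] 3[of v u "2 * (l - n) + 2" "{u, v}" "k + 1"]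
      by (simp add: T_def adj_def insert_commute split: if_splits)
    then show ?thesis ..
  next
    assume "\<not> k < 2 * n" "\<not> l < 2 * n"
    then show ?thesis
      using assms(2,3) 2[of "{u, v}" "k + 1" "l + 1"] by (simp add: adj_def)
  qed
qed

text \<open>Pigeonhole: there are at most \<open>2p - 1\<close> other vertices, whereas two
  neighbours for each of the \<open>p\<close> kinds would need \<open>2p\<close>.\<close>

lemma ex_kind_few_neighbours:
  assumes H: "nm_graph n m H" and card: "card (verts H) \<le> 2 * (2 * n + m)" and u: "u \<in> verts H"
  obtains k where "k < 2 * n + m" "\<And>v v'. adj n H k u v \<Longrightarrow> adj n H k u v' \<Longrightarrow> v = v'"
proof -
  have fin: "finite (verts H)"
    using H by (simp add: nm_graph_def)
  define N where "N k = {v. adj n H k u v}" for k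
  have N: "N k \<subseteq> verts H - {u}" for k
    using adj_verts(2,3)[OF H] by (fastforce simp: N_def)
  then have finN: "finite (N k)" for k
    using fin finite_subset by blast
  have "\<exists>k<2 * n + m. card (N k) \<le> Suc 0"
  proof (rule ccontr)
    assume "\<not> ?thesis"
    then have "2 \<le> card (N k)" if "k \<in> {..<2 * n + m}" for k
      using that by force
    then have "card {..<2 * n + m} * 2 \<le> (\<Sum>k<2 * n + m. card (N k))"
      using sum_bounded_below[of "{..<2 * n + m}" 2 "\<lambda>k. card (N k)"] by simp
    also have "\<dots> = card (\<Union>k<2 * n + m. N k)"
      using finN adj_kind_unique[OF H] by (intro card_UN_disjoint[symmetric]) (auto simp: N_def)
    also have "\<dots> \<le> card (verts H - {u})"
      using N fin by (intro card_mono) auto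
    also have "\<dots> < card (verts H)"
      using fin u by (rule card_Diff1_less)
    finally show False
      using card by simp
  qed
  then show thesis
    using that finN unfolding N_def by (metis (mono_tags, lifting) card_le_Suc0_iff_eq mem_Collect_eq)
qed

section \<open>Bouquets of cycles\<close>

lemma planar_straight_line:
  fixes p :: "'v \<Rightarrow> complex"
  assumes S: "simple_graph S" and inj: "inj_on p (sverts S)"
    and vert: "\<And>e v. e \<in> sedges S \<Longrightarrow> v \<in> sverts S \<Longrightarrow> p v \<in> convex hull (p ` e) \<Longrightarrow> v \<in> e"
    and cross: "\<And>e f. e \<in> sedges S \<Longrightarrow> f \<in> sedges S \<Longrightarrow> e \<noteq> f \<Longrightarrow>
      convex hull (p ` e) \<inter> convex hull (p ` f) \<subseteq> p ` (e \<inter> f)"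
  shows "planar S"
proof -
  have "\<exists>a b. e = {a, b} \<and> a \<noteq> b" if "e \<in> sedges S" for e
    using S that by (auto simp: simple_graph_def card_2_iff)
  then obtain s t where st: "\<And>e. e \<in> sedges S \<Longrightarrow> e = {s e, t e} \<and> s e \<noteq> t e"
    by metis
  define \<gamma> where "\<gamma> e = linepath (p (s e)) (p (t e))" for e
  have sub: "e \<subseteq> sverts S" if "e \<in> sedges S" for e
    using S that by (auto simp: simple_graph_def)
  have pe: "p ` e = {p (s e), p (t e)}" if "e \<in> sedges S" for e
    using st[OF that] by (metis image_empty image_insert)
  have img: "path_image (\<gamma> e) = convex hull (p ` e)" if "e \<in> sedges S" for e
    by (simp add: \<gamma>_def pe[OF that] segment_convex_hull)
  have "arc (\<gamma> e)" if "e \<in> sedges S" for e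
  proof -
    have "s e \<in> sverts S" "t e \<in> sverts S" "s e \<noteq> t e"
      using st[OF that] sub[OF that] by auto
    then have "p (s e) \<noteq> p (t e)"
      using inj by (auto dest: inj_onD)
    then show ?thesis
      by (simp add: \<gamma>_def arc_linepath)
  qed
  moreover have "{pathstart (\<gamma> e), pathfinish (\<gamma> e)} = p ` e" if "e \<in> sedges S" for e
    by (simp add: \<gamma>_def pe[OF that])
  moreover have "path_image (\<gamma> e) \<inter> p ` sverts S = p ` e" if "e \<in> sedges S" for e
    unfolding img[OF that] using vert[OF that] sub[OF that] hull_subset[of "p ` e" convex] by auto
  moreover have "path_image (\<gamma> e) \<inter> path_image (\<gamma> f) \<subseteq> p ` (e \<inter> f)"
    if "e \<in> sedges S" "f \<in> sedges S" "e \<noteq> f" for e f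
    unfolding img[OF that(1)] img[OF that(2)] using that by (rule cross)
  ultimately show ?thesis
    unfolding planar_def plane_drawing_def using inj by blast
qed

text \<open>Hub at the origin and rim vertex \<open>k\<close> at \<open>(k, 1)\<close>. One fan
  contains every bouquet: the root is the hub, and each cycle occupies a stretch of the rim.\<close>

definition fan_point :: "nat \<Rightarrow> complex" where
  "fan_point k = (if k = 0 then 0 else Complex (real k) 1)"

definition fan_edge :: "nat set \<Rightarrow> bool" where
  "fan_edge e \<longleftrightarrow> (\<exists>k>0. e = {0, k} \<or> e = {k, Suc k})"

lemma fan_spoke:
  assumes "k > 0" "z \<in> convex hull (fan_point ` {0, k})"
  shows "Re z = Im z * real k"
  using assms unfolding fan_point_def by (auto simp: segment_convex_hull[symmetric] in_segment)

lemma fan_rim: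
  assumes "k > 0" "z \<in> convex hull (fan_point ` {k, Suc k})"
  shows "Im z = 1" "real k \<le> Re z" "Re z \<le> real k + 1"
proof -
  obtain u where u: "0 \<le> u" "u \<le> 1" "z = (1 - u) *\<^sub>R Complex (real k) 1 + u *\<^sub>R Complex (real k + 1) 1"
    using assms unfolding fan_point_def by (auto simp: segment_convex_hull[symmetric] in_segment add.commute)
  then show "Im z = 1"
    by simp
  have "Re z = real k + u"
    by (simp add: u(3) algebra_simps)
  with u show "real k \<le> Re z" "Re z \<le> real k + 1"
    by simp_all
qed

lemma fan_vertex:
  assumes "fan_edge e" "fan_point v \<in> convex hull (fan_point ` e)"
  shows "v \<in> e"
proof -
  obtain k where k: "k > 0" "e = {0, k} \<or> e = {k, Suc k}"
    using assms(1) by (auto simp: fan_edge_def)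
  from k(2) show ?thesis
  proof
    assume e: "e = {0, k}"
    then show ?thesis
      using fan_spoke[OF k(1), of "fan_point v"] assms(2) by (auto simp: fan_point_def split: if_splits)
  next
    assume e: "e = {k, Suc k}"
    then show ?thesis
      using fan_rim[OF k(1), of "fan_point v"] assms(2) by (auto simp: fan_point_def split: if_splits)
  qed
qed

text \<open>Distinct spokes lie on distinct lines through the origin, and rim edges lie at height
  \<open>1\<close>, where a spoke has only its end point.\<close>

lemma fan_cross:
  assumes "fan_edge e" "fan_edge f" "e \<noteq> f"
    and z: "z \<in> convex hull (fan_point ` e)" "z \<in> convex hull (fan_point ` f)"
  shows "z \<in> fan_point ` (e \<inter> f)"
proof -
  have mixed: "z \<in> fan_point ` ({0, k} \<inter> {l, Suc l})"
    if "k > 0" "l > 0" "z \<in> convex hull (fan_point ` {0, k})" "z \<in> convex hull (fan_point ` {l, Suc l})" for k l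
  proof -
    have *: "Im z = 1" "Re z = real k"
      using fan_spoke[OF that(1,3)] fan_rim(1)[OF that(2,4)] by simp_all
    then have "k = l \<or> k = Suc l"
      using fan_rim(2,3)[OF that(2,4)] by linarith
    moreover have "z = fan_point k"
      using * that(1) by (simp add: fan_point_def complex_eq_iff)
    ultimately show ?thesis
      by auto
  qed
  have rims: "z \<in> fan_point ` ({k, Suc k} \<inter> {l, Suc l})"
    if "k > 0" "k < l" "z \<in> convex hull (fan_point ` {k, Suc k})" "z \<in> convex hull (fan_point ` {l, Suc l})" for k l
  proof -
    have "l > 0"
      using that by simp
    have *: "Im z = 1" "Re z \<le> real k + 1" "real l \<le> Re z"
      using fan_rim[OF that(1,3)] fan_rim[OF \<open>l > 0\<close> that(4)] by simp_all
    then have l: "l = Suc k"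
      using that(2) by linarith
    moreover have "z = fan_point l"
      using * l by (simp add: fan_point_def complex_eq_iff)
    ultimately show ?thesis
      by auto
  qed
  obtain k where k: "k > 0" "e = {0, k} \<or> e = {k, Suc k}"
    using assms(1) by (auto simp: fan_edge_def)
  obtain l where l: "l > 0" "f = {0, l} \<or> f = {l, Suc l}"
    using assms(2) by (auto simp: fan_edge_def)
  from k(2) l(2) show ?thesis
  proof (elim disjE)
    assume ef: "e = {0, k}" "f = {0, l}"
    have "Re z = Im z * real k" "Re z = Im z * real l"
      using fan_spoke[OF k(1), of z] fan_spoke[OF l(1), of z] z unfolding ef by blast+
    moreover have "k \<noteq> l"
      using ef assms(3) by auto
    ultimately have "z = fan_point 0"
      by (simp add: fan_point_def complex_eq_iff)
    with ef show ?thesis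
      by auto
  next
    assume ef: "e = {0, k}" "f = {l, Suc l}"
    then show ?thesis
      using mixed[OF k(1) l(1)] z by simp
  next
    assume ef: "e = {k, Suc k}" "f = {0, l}"
    then show ?thesis
      using mixed[OF l(1) k(1)] z by (simp add: Int_commute)
  next
    assume ef: "e = {k, Suc k}" "f = {l, Suc l}"
    then have "k \<noteq> l"
      using assms(3) by auto
    then show ?thesis
      using rims[OF k(1), of l] rims[OF l(1), of k] z ef by (cases "k < l") (auto simp: Int_commute)
  qed
qed

lemma inj_fan_point: "inj fan_point"
  by (auto simp: inj_on_def fan_point_def complex_eq_iff split: if_splits)

lemma planar_subgraph_of_fan:
  assumes S: "simple_graph S" and h: "inj h" "sverts S \<subseteq> range h"
    and fan: "\<And>e. e \<in> sedges S \<Longrightarrow> \<exists>e'. fan_edge e' \<and> e = h ` e'"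
  shows "planar S"
proof (rule planar_straight_line[OF S, where p = "fan_point \<circ> inv h"])
  have h': "(fan_point \<circ> inv h) ` h ` e' = fan_point ` e'" for e'
    using h(1) by (simp add: image_comp)
  show "inj_on (fan_point \<circ> inv h) (sverts S)"
    using h inj_fan_point by (intro comp_inj_on inj_on_inv_into) (auto intro: inj_on_subset)
  show "v \<in> e" if ev: "e \<in> sedges S" "v \<in> sverts S"
    "(fan_point \<circ> inv h) v \<in> convex hull ((fan_point \<circ> inv h) ` e)" for e v
  proof -
    obtain e' where e': "fan_edge e'" "e = h ` e'"
      using fan ev(1) by blast
    obtain i where i: "v = h i"
      using h(2) ev(2) by blast
    have "i \<in> e'"
      using fan_vertex[OF e'(1), of i] ev(3) h(1) unfolding e'(2) h' i by simp
    then show ?thesis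
      by (simp add: e'(2) i)
  qed
  show "convex hull ((fan_point \<circ> inv h) ` e) \<inter> convex hull ((fan_point \<circ> inv h) ` f) \<subseteq> (fan_point \<circ> inv h) ` (e \<inter> f)"
    if ef: "e \<in> sedges S" "f \<in> sedges S" "e \<noteq> f" for e f
  proof -
    obtain e' where e': "fan_edge e'" "e = h ` e'"
      using fan ef(1) by blast
    obtain f' where f': "fan_edge f'" "f = h ` f'"
      using fan ef(2) by blast
    have ef_Int: "e \<inter> f = h ` (e' \<inter> f')"
      using h(1) by (simp add: e'(2) f'(2) image_Int)
    have "e' \<noteq> f'"
      using ef(3) e' f' by auto
    then have "convex hull (fan_point ` e') \<inter> convex hull (fan_point ` f') \<subseteq> fan_point ` (e' \<inter> f')"
      using fan_cross[OF e'(1) f'(1)] by blast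
    then show ?thesis
      unfolding ef_Int h' unfolding e'(2) f'(2) h' .
  qed
qed

text \<open>Cycle \<open>c\<close> of the bouquet has length \<open>q\<close>; its vertices \<open>0\<close> and \<open>q\<close> are the common root.\<close>
definition bouquet_vertex :: "nat \<Rightarrow> nat \<Rightarrow> nat \<Rightarrow> nat" where
  "bouquet_vertex q c i = (if i = 0 \<or> i = q then 0 else c * q + i)"

lemma bouquet_vertex_eq_iff:
  assumes "i \<le> q" "i' \<le> q"
  shows "bouquet_vertex q c i = bouquet_vertex q c' i' \<longleftrightarrow>
    (i = 0 \<or> i = q) \<and> (i' = 0 \<or> i' = q) \<or> 0 < i \<and> i < q \<and> i = i' \<and> c = c'"
proof -
  have "c = c' \<and> i = i'" if "c * q + i = c' * q + i'" "i < q" "i' < q"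
  proof -
    have "(c * q + i) div q = c" "(c' * q + i') div q = c'"
      using that(2,3) by simp_all
    then show ?thesis
      using that(1) by simp
  qed
  then show ?thesis
    using assms by (cases "i = 0 \<or> i = q"; cases "i' = 0 \<or> i' = q") (auto simp: bouquet_vertex_def)
qed

lemma bouquet_edge_inj:
  assumes "3 \<le> q" "i < q" "i' < q"
    and "{bouquet_vertex q c i, bouquet_vertex q c (Suc i)} = {bouquet_vertex q c' i', bouquet_vertex q c' (Suc i')}"
  shows "c = c' \<and> i = i'"
  using assms by (auto simp: doubleton_eq_iff bouquet_vertex_eq_iff)

lemma fan_edge_bouquet:
  assumes "3 \<le> q" "i < q"
  shows "fan_edge {bouquet_vertex q c i, bouquet_vertex q c (Suc i)}"
proof -
  consider "i = 0" | "0 < i" "Suc i < q" | "0 < i" "Suc i = q"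
    using assms by linarith
  then show ?thesis
  proof cases
    case 1
    then show ?thesis
      using assms unfolding fan_edge_def by (intro exI[of _ "bouquet_vertex q c 1"]) (auto simp: bouquet_vertex_def)
  next
    case 2
    then show ?thesis
      unfolding fan_edge_def by (intro exI[of _ "bouquet_vertex q c i"]) (auto simp: bouquet_vertex_def)
  next
    case 3
    then show ?thesis
      unfolding fan_edge_def
      by (intro exI[of _ "bouquet_vertex q c i"]) (auto simp: bouquet_vertex_def insert_commute)
  qed
qed

section \<open>Cycles inside a bouquet\<close>

lemma cycle_neighbours:
  assumes "is_cycle S xs" "x \<in> set xs"
  obtains y z where "y \<noteq> z" "y \<in> set xs" "z \<in> set xs" "{x, y} \<in> sedges S" "{x, z} \<in> sedges S"
proof -
  let ?l = "length xs"
  have l: "?l \<ge> 3" "distinct xs" and E: "\<And>i. i < ?l \<Longrightarrow> {xs ! i, xs ! (Suc i mod ?l)} \<in> sedges S"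
    using assms(1) by (auto simp: is_cycle_def)
  obtain i where i: "i < ?l" "x = xs ! i"
    using assms(2) by (auto simp: in_set_conv_nth)
  define j where "j = (if i = 0 then ?l - 1 else i - 1)"
  define k where "k = Suc i mod ?l"
  have "k < ?l"
    unfolding k_def using l(1) by (intro mod_less_divisor) linarith
  then have jk: "j < ?l" "k < ?l" "Suc j mod ?l = i"
    using i by (auto simp: j_def)
  have "k \<noteq> j"
    using i l by (auto simp: j_def k_def mod_Suc split: if_splits)
  then have "xs ! k \<noteq> xs ! j"
    using jk l by (simp add: nth_eq_iff_index_eq)
  moreover have "{x, xs ! k} \<in> sedges S" "{x, xs ! j} \<in> sedges S"
    using E[OF i(1)] E[OF jk(1)] jk(3) i by (simp_all add: k_def insert_commute)
  ultimately show thesis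
    using that jk by simp
qed

text \<open>A vertex other than the root has degree two, so a cycle through it contains both its
  neighbours and, step by step, its whole petal. A cycle has at least three vertices and hence one
  that is not the root.\<close>

lemma bouquet_cycle_length:
  assumes q: "3 \<le> q" and h: "inj h" and cyc: "is_cycle S xs"
    and E: "sedges S = (\<lambda>(c, i). {h (bouquet_vertex q c i), h (bouquet_vertex q c (Suc i))}) ` ({..<M} \<times> {..<q})"
  shows "q \<le> length xs"
proof -
  let ?b = "bouquet_vertex q"
  have hE: "\<exists>c i. i < q \<and> {a, b} = {?b c i, ?b c (Suc i)}" if "{h a, h b} \<in> sedges S" for a b
  proof -
    obtain c i where "i < q" "{h a, h b} = {h (?b c i), h (?b c (Suc i))}"
      using \<open>{h a, h b} \<in> sedges S\<close> E by auto
    then have "h ` {a, b} = h ` {?b c i, ?b c (Suc i)}"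
      by simp
    with h \<open>i < q\<close> show ?thesis
      by (metis inj_image_eq_iff)
  qed
  have rng: "\<exists>b. y = h b" if "{x, y} \<in> sedges S" for x y
    using that E by (auto simp: doubleton_eq_iff)
  have nbr: "b = ?b c (Suc i) \<or> b = ?b c (i - 1)" if edge: "{h (?b c i), h b} \<in> sedges S" and "0 < i" "i < q" for c i b
  proof -
    obtain c' i' where "i' < q" "{?b c i, b} = {?b c' i', ?b c' (Suc i')}"
      using hE[OF edge] by blast
    then show ?thesis
      using that(2,3) q by (auto simp: doubleton_eq_iff bouquet_vertex_eq_iff)
  qed
  have both: "h (?b c (Suc i)) \<in> set xs \<and> h (?b c (i - 1)) \<in> set xs"
    if in_xs: "h (?b c i) \<in> set xs" and i: "0 < i" "i < q" for c i
  proof -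
    obtain y z where yz: "y \<noteq> z" "y \<in> set xs" "z \<in> set xs" "{h (?b c i), y} \<in> sedges S" "{h (?b c i), z} \<in> sedges S"
      using cycle_neighbours[OF cyc in_xs] by blast
    obtain a b where "y = h a" "z = h b"
      using rng yz(4,5) by blast
    then show ?thesis
      using nbr[of c i a] nbr[of c i b] yz i by auto
  qed
  have len: "length xs \<ge> 3" "distinct xs"
    using cyc by (auto simp: is_cycle_def)
  have "\<not> set xs \<subseteq> {h 0}"
    using card_mono[of "{h 0}" "set xs"] len by (auto simp: distinct_card)
  then obtain x where x: "x \<in> set xs" "x \<noteq> h 0"
    by blast
  obtain y where "{x, y} \<in> sedges S"
    using cycle_neighbours[OF cyc x(1)] by blast
  then obtain c i where "i < q" "{x, y} = {h (?b c i), h (?b c (Suc i))}"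
    using E by auto
  then have "x = h (?b c i) \<and> i \<le> q \<or> x = h (?b c (Suc i)) \<and> Suc i \<le> q"
    by (auto simp: doubleton_eq_iff)
  then obtain c i where ci: "i \<le> q" "x = h (?b c i)"
    by blast
  then have i: "0 < i" "i < q"
    using x(2) by (auto simp: bouquet_vertex_def le_less split: if_splits)
  have up: "i + k \<le> q \<longrightarrow> h (?b c (i + k)) \<in> set xs" for k
  proof (induction k)
    case (Suc k)
    then show ?case using both[of c "i + k"] i by auto
  qed (use x ci in simp)
  have down: "k \<le> i \<longrightarrow> h (?b c (i - k)) \<in> set xs" for k
  proof (induction k)
    case (Suc k)
    then show ?case using both[of c "i - k"] i by auto
  qed (use x ci in simp)
  have "h (?b c j) \<in> set xs" if "j < q" for j
    using up[of "j - i"] down[of "i - j"] that by (cases "i \<le> j") auto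
  then have sub: "(\<lambda>j. h (?b c j)) ` {..<q} \<subseteq> set xs"
    by auto
  have "inj_on (\<lambda>j. h (?b c j)) {..<q}"
  proof (rule inj_onI)
    fix j j' assume j: "j \<in> {..<q}" "j' \<in> {..<q}" and "h (?b c j) = h (?b c j')"
    then have "?b c j = ?b c j'"
      using h by (simp only: inj_eq)
    then show "j = j'"
      using j bouquet_vertex_eq_iff[of j q j' c c] by auto
  qed
  then have "q = card ((\<lambda>j. h (?b c j)) ` {..<q})"
    by (simp add: card_image)
  also have "\<dots> \<le> card (set xs)"
    using sub by (rule card_mono[OF finite_set])
  finally show ?thesis
    using distinct_card[OF len(2)] by simp
qed

lemma no_small_target:
  fixes n m g :: nat
  assumes p: "0 < 2 * n + m"
  shows "\<exists>G :: 'v::infinite mixed_graph. nm_graph n m G \<and> und G \<in> planar_girth g \<and>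
    (\<forall>(H :: 'w mixed_graph) f. nm_graph n m H \<and> card (verts H) \<le> 2 * (2 * n + m) \<longrightarrow> \<not> is_hom G H f)"
proof -
  \<comment> \<open>\<open>q\<close> is odd, so the two ways from the root to vertex
    \<open>L\<close> of a petal have lengths \<open>L\<close> and \<open>L + 1\<close>;
    \<open>L = Suc g\<close> makes \<open>q\<close> at least \<open>g\<close> and at least
    \<open>3\<close>.\<close>
  define p L q where "p = 2 * n + m" and "L = Suc g" and "q = 2 * L + 1"
  have q: "3 \<le> q" "g \<le> q"
    by (auto simp: q_def L_def)
  obtain h :: "nat \<Rightarrow> 'v" where h: "inj h"
    using infinite_UNIV infinite_countable_subset by blast
  \<comment> \<open>The sequences have length \<open>L + 1\<close>, the number of steps on the
    longer way.\<close>
  have "finite {ks. set ks \<subseteq> {..<p} \<and> length ks = Suc L}"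
    by (rule finite_lists_length_eq) simp
  then obtain kss where kss: "set kss = {ks. set ks \<subseteq> {..<p} \<and> length ks = Suc L}"
    by (meson finite_list)
  define M where "M = length kss"
  have kss_less: "kss ! c ! j < p" if "c < M" "j \<le> L" for c j
  proof -
    have "kss ! c \<in> set kss"
      using that by (simp add: M_def)
    then have "set (kss ! c) \<subseteq> {..<p}" "length (kss ! c) = Suc L"
      using kss by auto
    then show ?thesis
      using that(2) by (metis le_imp_less_Suc lessThan_iff nth_mem subsetD)
  qed
  let ?b = "\<lambda>c i. h (bouquet_vertex q c i)"
  \<comment> \<open>The first \<open>L\<close> edges carry \<open>kss ! c\<close> read away from the
    root; the other \<open>L + 1\<close> carry it from its beginning again, read from the other end
    of the cycle.\<close>
  define arrow where "arrow c i = (if i < L then (?b c i, ?b c (Suc i), kss ! c ! i)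
    else (?b c (Suc i), ?b c i, kss ! c ! (q - 1 - i)))" for c i
  define D where "D = (\<lambda>(c, i). arrow c i) ` ({..<M} \<times> {..<q})"
  define V where "V = h ` {..(Suc M) * q}"
  define G where "G = kind_graph n V D"
  have b_inj: "?b c i = ?b c' i' \<longleftrightarrow> bouquet_vertex q c i = bouquet_vertex q c' i'" for c i c' i'
    using h by (simp add: inj_eq)
  have D_cases: "\<exists>c i. c < M \<and> i < q \<and> (u, v, k) = arrow c i \<and> {u, v} = {?b c i, ?b c (Suc i)}"
    if uvk: "(u, v, k) \<in> D" for u v k
  proof -
    obtain c i where ci: "c < M" "i < q" "(u, v, k) = arrow c i"
      using uvk unfolding D_def by auto
    then have "{u, v} = {?b c i, ?b c (Suc i)}"
      by (auto simp: arrow_def insert_commute split: if_splits)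
    with ci show ?thesis
      by blast
  qed
  have finV: "finite V"
    by (simp add: V_def)
  have b_V: "?b c i \<in> V" if "c < M" "i \<le> q" for c i
  proof -
    have "c * q + i \<le> c * q + q"
      using \<open>i \<le> q\<close> by simp
    also have "\<dots> = Suc c * q"
      by simp
    also have "\<dots> \<le> Suc M * q"
      using \<open>c < M\<close> by (intro mult_le_mono1) simp
    finally show ?thesis
      by (auto simp: V_def bouquet_vertex_def)
  qed
  have nm: "nm_graph n m G"
    unfolding G_def
  proof (rule nm_graph_kind_graph[OF finV])
    fix u v k assume "(u, v, k) \<in> D"
    then obtain c i where ci: "c < M" "i < q" "(u, v, k) = arrow c i"
      using D_cases by blast
    have "?b c i \<noteq> ?b c (Suc i)"
      using ci(2) q by (auto simp: b_inj bouquet_vertex_eq_iff)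
    then show "u \<in> V \<and> v \<in> V \<and> u \<noteq> v \<and> k < 2 * n + m"
      using ci b_V[of c i] b_V[of c "Suc i"] kss_less[of c i] kss_less[of c "q - 1 - i"]
      by (auto simp: arrow_def p_def q_def split: if_splits)
  next
    fix u v k u' v' k' assume uv: "(u, v, k) \<in> D" "(u', v', k') \<in> D" and eq: "{u, v} = {u', v'}"
    obtain c i where ci: "i < q" "(u, v, k) = arrow c i" "{u, v} = {?b c i, ?b c (Suc i)}"
      using D_cases[OF uv(1)] by blast
    obtain c' i' where ci': "i' < q" "(u', v', k') = arrow c' i'" "{u', v'} = {?b c' i', ?b c' (Suc i')}"
      using D_cases[OF uv(2)] by blast
    have "h ` {bouquet_vertex q c i, bouquet_vertex q c (Suc i)}
        = h ` {bouquet_vertex q c' i', bouquet_vertex q c' (Suc i')}"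
      using eq ci(3) ci'(3) by simp
    then have "c = c' \<and> i = i'"
      using bouquet_edge_inj[OF q(1) ci(1) ci'(1)] h by (simp only: inj_image_eq_iff)
    then have "(u, v, k) = (u', v', k')"
      using ci(2) ci'(2) by simp
    then show "u = u' \<and> v = v' \<and> k = k'"
      by simp
  qed
  have E: "sedges (und G) = (\<lambda>(c, i). {?b c i, ?b c (Suc i)}) ` ({..<M} \<times> {..<q})"
  proof -
    have "(\<lambda>(u, v, k). {u, v}) (arrow c i) = {?b c i, ?b c (Suc i)}" for c i
      by (simp add: arrow_def insert_commute)
    then show ?thesis
      unfolding G_def und_kind_graph D_def by (simp add: image_image case_prod_beta)
  qed
  have VG: "sverts (und G) = V"
    by (simp add: G_def und_kind_graph)
  have simple: "simple_graph (und G)"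
    unfolding simple_graph_def VG
  proof (intro conjI ballI)
    fix e assume "e \<in> sedges (und G)"
    then obtain c i where ci: "c < M" "i < q" "e = {?b c i, ?b c (Suc i)}"
      unfolding E by auto
    have "?b c i \<noteq> ?b c (Suc i)"
      using ci(2) q by (auto simp: b_inj bouquet_vertex_eq_iff)
    then show "e \<subseteq> V" "card e = 2"
      using ci b_V[of c i] b_V[of c "Suc i"] by auto
  qed (rule finV)
  have "planar (und G)"
  proof (rule planar_subgraph_of_fan[OF simple h])
    show "sverts (und G) \<subseteq> range h"
      unfolding VG V_def by auto
    fix e assume "e \<in> sedges (und G)"
    then obtain c i where ci: "c < M" "i < q" "e = {?b c i, ?b c (Suc i)}"
      unfolding E by auto
    then show "\<exists>e'. fan_edge e' \<and> e = h ` e'"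
      using fan_edge_bouquet[OF q(1) ci(2), of c] by (intro exI conjI) auto
  qed
  moreover have "enat g \<le> girth (und G)"
    unfolding girth_def
  proof (intro INF_greatest)
    fix xs assume "xs \<in> {xs. is_cycle (und G) xs}"
    then have "q \<le> length xs"
      using bouquet_cycle_length[OF q(1) h _ E] by simp
    with q(2) show "enat g \<le> enat (length xs)"
      by simp
  qed
  ultimately have "und G \<in> planar_girth g"
    using simple by (simp add: planar_girth_def)
  moreover have "\<not> is_hom G H f"
    if H: "nm_graph n m H" and cardH: "card (verts H) \<le> 2 * (2 * n + m)" for H :: "'w mixed_graph" and f
  proof
    assume hom: "is_hom G H f"
    \<comment> \<open>A kind below \<open>p\<close> is chosen outside \<open>H\<close> too, so that
      every sequence formed from these choices occurs in \<open>kss\<close>.\<close>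
    have "\<exists>k. k < p \<and> (u \<in> verts H \<longrightarrow> (\<forall>v v'. adj n H k u v \<longrightarrow> adj n H k u v' \<longrightarrow> v = v'))" for u
    proof (cases "u \<in> verts H")
      case True
      then obtain k where "k < p" "\<And>v v'. adj n H k u v \<Longrightarrow> adj n H k u v' \<Longrightarrow> v = v'"
        unfolding p_def using ex_kind_few_neighbours[OF H cardH True] by metis
      then show ?thesis
        by blast
    next
      case False
      with p show ?thesis
        by (intro exI[of _ 0]) (simp add: p_def)
    qed
    then obtain \<kappa> where \<kappa>: "\<And>u. \<kappa> u < p"
      "\<And>u v v'. u \<in> verts H \<Longrightarrow> adj n H (\<kappa> u) u v \<Longrightarrow> adj n H (\<kappa> u) u v' \<Longrightarrow> v = v'"
      by metis
    \<comment> \<open>\<open>w\<close> depends only on \<open>H\<close> and the image of the root,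
      so the cycle \<open>c\<close> can be chosen afterwards. Where no neighbour of the chosen kind
      exists, the value of \<open>SOME\<close> is arbitrary; \<open>next_eq\<close> applies only
      where one does.\<close>
    define w where "w = rec_nat (f (h 0)) (\<lambda>_ u. SOME v. adj n H (\<kappa> u) u v)"
    have w0: "w 0 = f (h 0)" and wSuc: "w (Suc j) = (SOME v. adj n H (\<kappa> (w j)) (w j) v)" for j
      by (simp_all add: w_def)
    have next_eq: "w (Suc j) = v" if "adj n H (\<kappa> (w j)) (w j) v" for j v
    proof -
      have "adj n H (\<kappa> (w j)) (w j) (w (Suc j))"
        unfolding wSuc using that by (rule someI)
      then show ?thesis
        using \<kappa>(2) adj_verts(1)[OF H that] that by blast
    qed
    have "map (\<lambda>j. \<kappa> (w j)) [0..<Suc L] \<in> set kss"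
      unfolding kss using \<kappa>(1) by auto
    then obtain c where c: "c < M" "kss ! c = map (\<lambda>j. \<kappa> (w j)) [0..<Suc L]"
      by (auto simp: in_set_conv_nth M_def)
    have kc: "kss ! c ! j = \<kappa> (w j)" if "j \<le> L" for j
      using that by (simp add: c(2) nth_map_upt del: upt_Suc)
    have step: "adj n H k (f u) (f v)" if "(u, v, k) = arrow c i" "i < q" for u v k i
    proof -
      have "(u, v, k) \<in> D"
        using c(1) that by (auto simp: D_def)
      then show ?thesis
        unfolding G_def[symmetric] using hom by (intro hom_adj[OF hom]) (simp add: G_def adj_kind_graph)
    qed
    have up: "adj n H (\<kappa> (w i)) (f (?b c i)) (f (?b c (Suc i)))" if "i < L" for i
      using step[of "?b c i" "?b c (Suc i)" "\<kappa> (w i)" i] that kc[of i] by (simp add: arrow_def q_def)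
    have down: "adj n H (\<kappa> (w j)) (f (?b c (q - j))) (f (?b c (q - Suc j)))" if "j \<le> L" for j
    proof -
      have *: "q - 1 - (q - Suc j) = j" "\<not> q - Suc j < L" "Suc (q - Suc j) = q - j" "q - Suc j < q"
        using that by (auto simp: q_def)
      show ?thesis
        using step[of "?b c (q - j)" "?b c (q - Suc j)" "\<kappa> (w j)" "q - Suc j"] * kc[OF that]
        by (simp add: arrow_def)
    qed
    have b0: "bouquet_vertex q c 0 = 0" "bouquet_vertex q c q = 0"
      by (simp_all add: bouquet_vertex_def)
    have walk_up: "i \<le> L \<longrightarrow> f (?b c i) = w i" for i
    proof (induction i)
      case 0
      show ?case by (simp add: b0 w0)
    next
      case (Suc i)
      then show ?case
        using up[of i] next_eq[of i "f (?b c (Suc i))"] by auto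
    qed
    have walk_down: "j \<le> L \<longrightarrow> f (?b c (q - j)) = w j" for j
    proof (induction j)
      case 0
      show ?case by (simp add: b0 w0)
    next
      case (Suc j)
      then show ?case
        using down[of j] next_eq[of j "f (?b c (q - Suc j))"] by auto
    qed
    have "q - Suc L = L"
      by (simp add: q_def)
    \<comment> \<open>The last step of the longer way starts at the image \<open>w L\<close> and
      ends at the vertex where the shorter way has arrived, also with image \<open>w L\<close>: a
      loop in \<open>H\<close>.\<close>
    then have "adj n H (\<kappa> (w L)) (w L) (w L)"
      using down[of L] walk_up[of L] walk_down[of L] by simp
    then show False
      using adj_verts(3)[OF H] by blast
  qed
  ultimately show ?thesis
    using nm by blast
qed

section \<open>Homomorphisms to the Walecki graph\<close>

text \<open>Cycles \<open>2k\<close> and \<open>2k + 1\<close> carry the outgoing kind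
  \<open>k < n\<close>, directed along their successor maps; cycle \<open>i >= 2n\<close> carries
  the edge kind \<open>i\<close>.\<close>

definition walecki_graph :: "nat \<Rightarrow> nat \<Rightarrow> nat mixed_graph" where
  "walecki_graph n m = (let p = 2 * n + m in
     kind_graph n {..2 * p}
      ((\<lambda>(i, x). (nat x, nat (walecki (int p) (int i) x), if i < 2 * n then i div 2 else i))
        ` ({..<p} \<times> {0..2 * int p})))"

text \<open>Meant for kinds \<open>k < n\<close> and \<open>k >= 2n\<close>: arcs are always read
  from their tail, as \<open>und_edge_kind\<close> arranges.\<close>

definition walecki_rel :: "nat \<Rightarrow> nat \<Rightarrow> nat \<Rightarrow> (int \<times> int) set" where
  "walecki_rel n p k =
     (if k < n then (\<lambda>x. (x, walecki p (2 * int k) x)) ` {0..2 * int p} \<union>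
        (\<lambda>x. (x, walecki p (2 * int k + 1) x)) ` {0..2 * int p}
      else (\<lambda>x. (x, walecki p (int k) x)) ` {0..2 * int p} \<union>
        (\<lambda>x. (walecki p (int k) x, x)) ` {0..2 * int p})"

lemma nm_walecki_graph:
  assumes p: "2 \<le> 2 * n + m"
  shows "nm_graph n m (walecki_graph n m)"
proof -
  define p where "p = 2 * n + m"
  have p2: "int p \<ge> 2"
    using assms by (simp add: p_def)
  let ?D = "(\<lambda>(i, x). (nat x, nat (walecki (int p) (int i) x), if i < 2 * n then i div 2 else i))
        ` ({..<p} \<times> {0..2 * int p})"
  have D: "\<exists>i x. i < p \<and> x \<in> {0..2 * int p} \<and> u = nat x \<and> v = nat (walecki (int p) (int i) x)
      \<and> k = (if i < 2 * n then i div 2 else i)" if "(u, v, k) \<in> ?D" for u v k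
    using that unfolding image_def
    by (simp only: mem_Collect_eq Bex_def split_paired_Ex prod.case mem_Sigma_iff Pair_inject lessThan_iff) blast
  note W = walecki_in[OF p2]
  show ?thesis
    unfolding walecki_graph_def Let_def p_def[symmetric]
  proof (rule nm_graph_kind_graph)
    fix u v k assume "(u, v, k) \<in> ?D"
    then obtain i x where ix: "i < p" "x \<in> {0..2 * int p}" "u = nat x" "v = nat (walecki (int p) (int i) x)"
      "k = (if i < 2 * n then i div 2 else i)"
      using D by blast
    have "walecki (int p) (int i) x \<in> {0..2 * int p}" "walecki (int p) (int i) x \<noteq> x"
      using W[OF ix(2)] walecki_no_2_cycle(1)[OF p2 ix(2)] by auto
    then have "u \<in> {..2 * p}" "v \<in> {..2 * p}" "u \<noteq> v"
      using ix(2) by (auto simp: ix(3,4))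
    moreover have "k < 2 * n + m"
      using ix(1) by (auto simp: ix(5) p_def)
    ultimately show "u \<in> {..2 * p} \<and> v \<in> {..2 * p} \<and> u \<noteq> v \<and> k < 2 * n + m"
      by blast
  next
    fix u v k u' v' k' assume uv: "(u, v, k) \<in> ?D" "(u', v', k') \<in> ?D" and eq: "{u, v} = {u', v'}"
    obtain i x where ix: "i < p" "x \<in> {0..2 * int p}" "u = nat x" "v = nat (walecki (int p) (int i) x)"
      "k = (if i < 2 * n then i div 2 else i)"
      using D[OF uv(1)] by blast
    obtain j y where jy: "j < p" "y \<in> {0..2 * int p}" "u' = nat y" "v' = nat (walecki (int p) (int j) y)"
      "k' = (if j < 2 * n then j div 2 else j)"
      using D[OF uv(2)] by blast
    have "int u = x" "int v = walecki (int p) (int i) x" "int u' = y" "int v' = walecki (int p) (int j) y"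
      using W[OF ix(2), of "int i"] W[OF jy(2), of "int j"] ix(2) jy(2) by (simp_all add: ix(3,4) jy(3,4))
    moreover have "{int u, int v} = {int u', int v'}"
      using arg_cong[OF eq, of "image int"] by simp
    ultimately have "{x, walecki (int p) (int i) x} = {y, walecki (int p) (int j) y}"
      by simp
    then have "x = y \<and> int i = int j"
      by (rule walecki_edge_disjoint[OF p2 ix(2) jy(2), rotated 4]) (use ix(1) jy(1) in simp_all)
    then show "u = u' \<and> v = v' \<and> k = k'"
      by (simp add: ix jy)
  qed simp
qed

lemma card_walecki_graph: "card (verts (walecki_graph n m)) = 2 * (2 * n + m) + 1"
  by (simp add: walecki_graph_def Let_def)

lemma expands_walecki_rel:
  assumes "p \<ge> 2"
  shows "expands {0..2 * int p} 1 (walecki_rel n p k)"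
  using assms expands_walecki_arcs[of "int p"] expands_walecki_sym[of "int p"]
  by (simp add: walecki_rel_def)

lemma walecki_rel_adj:
  assumes xy: "(x, y) \<in> walecki_rel n (2 * n + m) k" and k: "k < n \<or> 2 * n \<le> k \<and> k < 2 * n + m"
  shows "adj n (walecki_graph n m) k (nat x) (nat y)"
proof -
  define p where "p = 2 * n + m"
  have *: "adj n (walecki_graph n m) (if i < 2 * n then i div 2 else i) (nat z) (nat (walecki (int p) (int i) z))"
    if "i < p" "z \<in> {0..2 * int p}" for i z
    unfolding walecki_graph_def Let_def p_def[symmetric] using that
    by (intro adj_kind_graph image_eqI[of _ _ "(i, z)"]) auto
  show ?thesis
  proof (cases "k < n")
    case True
    then show ?thesis
      using xy *[of "2 * k"] *[of "2 * k + 1"] unfolding walecki_rel_def p_def[symmetric]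
      by (auto simp: p_def add.commute)
  next
    case False
    then show ?thesis
      using k xy *[of k] adj_sym_edge[of k n "walecki_graph n m"]
      unfolding walecki_rel_def p_def[symmetric] by (auto simp: p_def)
  qed
qed

text \<open>With the excess \<open>d = card J + 1 - card (\<Union> J)\<close>, the face count says
  \<open>g * d <= 2 * card J\<close>, and \<open>g >= 8p\<close> turns this into
  \<open>4p * d <= card J\<close>. This is the sparsity condition for lengths
  \<open>1\<close>.\<close>

lemma sparse_of_girth:
  assumes S: "S \<in> planar_girth g" and g: "8 * p \<le> g" and J: "J \<subseteq> sedges S" "J \<noteq> {}"
  shows "4 * p * card J + 4 * p \<le> 4 * p * card (\<Union> J) + card J"
proof -
  obtain pt \<gamma> where simple: "simple_graph S" and "plane_drawing S pt \<gamma>"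
    using S by (auto simp: planar_girth_def planar_def)
  then interpret plane_graph S pt \<gamma>
    by unfold_locales
  have "g \<le> length xs" if "cycle_in J xs" for xs
  proof -
    have "is_cycle S xs"
      using that J(1) simple by (rule cycle_in_is_cycle)
    then have "girth S \<le> enat (length xs)"
      unfolding girth_def by (intro INF_lower) simp
    moreover have "enat g \<le> girth S"
      using S by (simp add: planar_girth_def)
    ultimately show ?thesis
      by (metis enat_ord_simps(1) order_trans)
  qed
  then have bound: "g * (card J + 1) \<le> 2 * card J + g * card (\<Union> J)"
    using girth_edge_bound[OF J] by blast
  show ?thesis
  proof (cases "card J + 1 \<le> card (\<Union> J)")
    case True
    then have "4 * p * (card J + 1) \<le> 4 * p * card (\<Union> J)"
      by (rule mult_le_mono2)
    then show ?thesis
      by simp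
  next
    case False
    then obtain d where d: "card J + 1 = card (\<Union> J) + d"
      by (metis le_add_diff_inverse nat_le_linear)
    then have "g * d \<le> 2 * card J"
      using bound by (simp only: d distrib_left)
    moreover have "8 * p * d \<le> g * d"
      using g by (rule mult_le_mono1)
    ultimately have "8 * p * d \<le> 2 * card J"
      by (rule order_trans[rotated])
    then have "4 * p * d \<le> card J"
      by (simp add: algebra_simps)
    moreover have "4 * p * card J + 4 * p = 4 * p * (card J + 1)"
      by simp
    ultimately show ?thesis
      unfolding d by (simp add: distrib_left)
  qed
qed

lemma und_edge_kind:
  assumes "nm_graph n m G" "e \<in> sedges (und G)"
  shows "\<exists>u v k. e = {u, v} \<and> (k < n \<or> 2 * n \<le> k \<and> k < 2 * n + m) \<and> adj n G k u v"
proof -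
  from assms(2) consider u v \<alpha> where "e = {u, v}" "(u, v, \<alpha>) \<in> arcs G" | \<alpha> where "(e, \<alpha>) \<in> edges G"
    by (auto simp: und_def)
  then show ?thesis
  proof cases
    case 1
    then have \<alpha>: "even \<alpha>" "2 \<le> \<alpha>" "\<alpha> \<le> 2 * n"
      using nm_graph_arc[OF assms(1)] by blast+
    then have "\<alpha> = 2 * (\<alpha> div 2 - 1) + 2" "\<alpha> div 2 - 1 < n"
      by auto
    with 1 have "e = {u, v} \<and> \<alpha> div 2 - 1 < n \<and> adj n G (\<alpha> div 2 - 1) u v"
      by (simp add: adj_def)
    then show ?thesis
      by blast
  next
    case 2
    then have "card e = 2" and \<alpha>: "2 * n + 1 \<le> \<alpha>" "\<alpha> \<le> 2 * n + m"
      using nm_graph_edge[OF assms(1)] by blast+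
    then obtain u v where "e = {u, v}"
      by (auto simp: card_2_iff)
    with 2 \<alpha> have "e = {u, v} \<and> 2 * n \<le> \<alpha> - 1 \<and> \<alpha> - 1 < 2 * n + m \<and> adj n G (\<alpha> - 1) u v"
      by (auto simp: adj_def)
    then show ?thesis
      by blast
  qed
qed

lemma hom_walecki_graph:
  fixes G :: "'v mixed_graph"
  assumes p: "2 \<le> 2 * n + m" and g: "8 * (2 * n + m) \<le> g"
    and G: "nm_graph n m G" and S: "und G \<in> planar_girth g"
  shows "\<exists>f. is_hom G (walecki_graph n m) f"
proof -
  define p where "p = 2 * n + m"
  define I where "I = sedges (und G)"
  let ?H = "walecki_graph n m"
  obtain s t k where stk: "\<And>e. e \<in> I \<Longrightarrow> e = {s e, t e} \<and> (k e < n \<or> 2 * n \<le> k e \<and> k e < p) \<and> adj n G (k e) (s e) (t e)"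
    using und_edge_kind[OF G] unfolding I_def p_def by metis
  have simple: "simple_graph (und G)"
    using S by (simp add: planar_girth_def)
  have "\<exists>c. (\<forall>v. c v \<in> {0..2 * int p}) \<and> (\<forall>e\<in>I. (c (s e), c (t e)) \<in> walecki_rel n p (k e))"
  \<comment> \<open>The indices are the edges themselves, each of length \<open>1\<close> because
    one adjacency gains one colour.\<close>
  proof (rule sparse_relational_colouring[where l = "\<lambda>_. 1"])
    show "finite I"
      unfolding I_def using simple finite_subset[of "sedges (und G)" "Pow (sverts (und G))"]
      by (auto simp: simple_graph_def)
    show "\<forall>e\<in>I. expands {0..2 * int p} 1 (walecki_rel n p (k e))"
      by (intro ballI expands_walecki_rel) (use p in \<open>simp add: p_def\<close>)
    show "\<forall>J. J \<subseteq> I \<and> J \<noteq> {} \<longrightarrow> 4 * p * card J + 4 * p \<le> 4 * p * card (s ` J \<union> t ` J) + (\<Sum>e\<in>J. 1)"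
    proof (intro allI impI, elim conjE)
      fix J assume J: "J \<subseteq> I" "J \<noteq> {}"
      have "s ` J \<union> t ` J = (\<Union>e\<in>J. {s e, t e})"
        by auto
      also have "\<dots> = \<Union> J"
        using stk J(1) by (metis (no_types, lifting) SUP_cong SUP_identity_eq image_ident subsetD)
      finally show "4 * p * card J + 4 * p \<le> 4 * p * card (s ` J \<union> t ` J) + (\<Sum>e\<in>J. 1)"
        using sparse_of_girth[OF S, of p J] J g by (simp add: p_def I_def)
    qed
  qed (use p in \<open>auto simp: p_def\<close>)
  then obtain c where c: "\<And>v. c v \<in> {0..2 * int p}" "\<And>e. e \<in> I \<Longrightarrow> (c (s e), c (t e)) \<in> walecki_rel n p (k e)"
    by blast
  define f where "f v = nat (c v)" for v
  have adjH: "adj n ?H (k e) (f (s e)) (f (t e))" if "e \<in> I" for e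
    using walecki_rel_adj[of "c (s e)" "c (t e)" n m "k e"] c(2)[OF that] stk[OF that]
    by (simp add: p_def f_def)
  have "f ` verts G \<subseteq> verts ?H"
    using c(1) by (auto simp: f_def walecki_graph_def Let_def p_def nat_le_iff)
  moreover have "(f u, f v, \<alpha>) \<in> arcs ?H" if arc: "(u, v, \<alpha>) \<in> arcs G" for u v \<alpha>
  proof -
    let ?e = "{u, v}"
    have e: "?e \<in> I"
      using arc by (auto simp: I_def und_def)
    note st = stk[OF e]
    show ?thesis
    proof (cases "k ?e < n")
      case True
      then have "(s ?e, t ?e, 2 * k ?e + 2) \<in> arcs G"
        using st by (simp add: adj_def)
      \<comment> \<open>A pair of vertices determines its arc, so the chosen ends and kind are those
        of the given arc.\<close>
      then have "(s ?e, t ?e, 2 * k ?e + 2) = (u, v, \<alpha>)"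
        using nm_graph_arcs_unique[OF G _ arc] st by metis
      then show ?thesis
        using adjH[OF e] True by (simp add: adj_def)
    next
      case False
      then have "({s ?e, t ?e}, k ?e + 1) \<in> edges G"
        using conjunct2[OF st] by (auto simp: adj_def)
      then show ?thesis
        using nm_graph_arc_edge[OF G arc] st by metis
    qed
  qed
  moreover have "(f ` e, \<alpha>) \<in> edges ?H" if edge: "(e, \<alpha>) \<in> edges G" for e \<alpha>
  proof -
    have e: "e \<in> I"
      unfolding I_def und_def using imageI[OF edge, of fst] by simp
    note st = stk[OF e]
    show ?thesis
    proof (cases "k e < n")
      case True
      then have "(s e, t e, 2 * k e + 2) \<in> arcs G"
        using st by (simp add: adj_def)
      then show ?thesis
        using nm_graph_arc_edge[OF G _ edge] st by metis
    next
      case False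
      then have "({s e, t e}, k e + 1) \<in> edges G"
        using conjunct2[OF st] by (auto simp: adj_def)
      then have "\<alpha> = k e + 1"
        using nm_graph_edges_unique[OF G edge] st by metis
      moreover have "f ` e = {f (s e), f (t e)}"
        using st by (metis image_empty image_insert)
      ultimately show ?thesis
        using adjH[OF e] False st by (simp add: adj_def)
    qed
  qed
  ultimately show ?thesis
    unfolding is_hom_def by blast
qed

text \<open>Shows that the maximum in \<open>chi_simple\<close> is over a nonempty set. Every edge
  gets kind \<open>0\<close>: an arc of type \<open>2\<close> if \<open>n > 0\<close>, an edge of
  type \<open>1\<close> otherwise.\<close>

lemma ex_nm_graph_und:
  fixes S :: "'v sgraph"
  assumes "simple_graph S" "0 < 2 * n + m"
  obtains G where "nm_graph n m G" "und G = S"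
proof -
  have "\<forall>e\<in>sedges S. \<exists>a b. e = {a, b} \<and> a \<noteq> b"
    using assms(1) by (auto simp: simple_graph_def card_2_iff)
  then obtain s t where st: "\<And>e. e \<in> sedges S \<Longrightarrow> e = {s e, t e} \<and> s e \<noteq> t e"
    by metis
  define D where "D = (\<lambda>e. (s e, t e, 0 :: nat)) ` sedges S"
  have D: "u = s {u, v} \<and> v = t {u, v} \<and> k = 0 \<and> {u, v} \<in> sedges S \<and> u \<noteq> v" if uvk: "(u, v, k) \<in> D" for u v k
  proof -
    obtain e where e: "e \<in> sedges S" "u = s e" "v = t e" "k = 0"
      using uvk by (auto simp: D_def)
    then have "{u, v} = e"
      using st by simp
    with e st show ?thesis
      by auto
  qed
  have "nm_graph n m (kind_graph n (sverts S) D)"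
  proof (rule nm_graph_kind_graph)
    show "finite (sverts S)"
      using assms(1) by (simp add: simple_graph_def)
    show "u \<in> sverts S \<and> v \<in> sverts S \<and> u \<noteq> v \<and> k < 2 * n + m" if "(u, v, k) \<in> D" for u v k
      using D[OF that] assms by (auto simp: simple_graph_def)
    show "u = u' \<and> v = v' \<and> k = k'"
      if "(u, v, k) \<in> D" "(u', v', k') \<in> D" "{u, v} = {u', v'}" for u v k u' v' k'
      using D[OF that(1)] D[OF that(2)] that(3) by metis
  qed
  moreover have "(\<lambda>(u, v, k). {u, v}) ` D = sedges S"
    using st by (force simp: D_def image_image)
  then have "und (kind_graph n (sverts S) D) = S"
    by (simp add: und_kind_graph)
  ultimately show thesis
    using that by blast
qed

theorem corollary3p9:
  fixes n m g :: nat
  assumes "2 * n + m \<ge> 1"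
    and "(n, m) \<noteq> (0, 1)"
    and "g \<ge> 8 * (2 * n + m)"
  shows "finite (chi_simple n m ` (planar_girth g :: 'v::infinite sgraph set)) \<and>
         chi_family n m (planar_girth g :: 'v sgraph set) = 2 * (2 * n + m) + 1"
proof -
  let ?N = "2 * (2 * n + m) + 1"
  let ?P = "planar_girth g :: 'v sgraph set"
  \<comment> \<open>As \<open>2n\<close> is even, \<open>2n + m = 1\<close> holds only for the
    excluded pair.\<close>
  have p: "2 \<le> 2 * n + m"
    using assms(1,2) by (cases n) auto
  have target: "\<exists>H :: nat mixed_graph. nm_graph n m H \<and> card (verts H) = ?N \<and> (\<exists>f. is_hom G H f)"
    if "nm_graph n m G" "und G \<in> ?P" for G
    using nm_walecki_graph[OF p] card_walecki_graph hom_walecki_graph[OF p assms(3) that] by blast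
  have chi_le: "chi n m G \<le> ?N" if "nm_graph n m G" "und G \<in> ?P" for G
    unfolding chi_def using target[OF that] by (rule Least_le)
  have simple_le: "chi_simple n m S \<le> ?N" if S: "S \<in> ?P" for S
  proof -
    have fin: "finite {chi n m G |G. nm_graph n m G \<and> und G = S}"
      by (rule finite_subset[of _ "{..?N}"]) (use chi_le S in auto)
    have "simple_graph S" "0 < 2 * n + m"
      using S assms(1) by (auto simp: planar_girth_def)
    then obtain G where "nm_graph n m G" "und G = S"
      by (rule ex_nm_graph_und)
    then show ?thesis
      unfolding chi_simple_def using fin chi_le S by (subst Max_le_iff) auto
  qed
  have "0 < 2 * n + m"
    using p by linarith
  then obtain G :: "'v mixed_graph" where G: "nm_graph n m G" "und G \<in> ?P"
    and no_hom: "\<forall>(H :: nat mixed_graph) f. nm_graph n m H \<and> card (verts H) \<le> 2 * (2 * n + m) \<longrightarrow> \<not> is_hom G H f"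
    using no_small_target[where ?'v = 'v and ?'w = nat] by metis
  have "\<exists>H :: nat mixed_graph. nm_graph n m H \<and> card (verts H) = chi n m G \<and> (\<exists>f. is_hom G H f)"
    unfolding chi_def using target[OF G] by (rule LeastI)
  then have "\<not> chi n m G \<le> 2 * (2 * n + m)"
    using no_hom by metis
  moreover have "chi n m G \<le> chi_simple n m (und G)"
    unfolding chi_simple_def
    by (rule Max_ge) (use G chi_le in \<open>auto intro!: finite_subset[of _ "{..?N}"]\<close>)
  ultimately have eq: "chi_simple n m (und G) = ?N"
    using simple_le[OF G(2)] by simp
  have fin: "finite (chi_simple n m ` ?P)"
    by (rule finite_subset[of _ "{..?N}"]) (use simple_le in auto)
  moreover have "Max (chi_simple n m ` ?P) = ?N"
    using fin simple_le G(2) eq by (intro Max_eqI) (auto intro: rev_image_eqI)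
  ultimately show ?thesis
    by (simp add: chi_family_def)
qed

end
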